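(* Let $M\in\mathbb{N}$ and let $V^{(1)},\ldots,V^{(M)}$ be real-valued random variables on a common probability space with $\mathbb{P}(V^{(i)}>0)>0$, $\mathbb{E}[V^{(i)}]<0$, and $\mathbb{E}[e^{\theta V^{(i)}}]<\infty$ for some $\theta>0$, for each $i$. For $1\le i\le M$ let $\theta_i:=\sup\{r>0:\ \mathbb{E}[e^{rV^{(j)}}]\le1\ \text{for all }1\le j\le i\}$. Let $I_i(\theta):=1$ if $\mathbb{E}[e^{\theta V^{(i)}}]=1$ and $I_i(\theta):=0$ otherwise, and $$d_1(\theta):=0,\qquad d_j(\theta):=I_2(\theta)+\cdots+I_j(\theta),\quad 2\le j\le M.$$ Let $a\in\mathbb{R}$ and $$\mathcal{D}^M_a:=\{(v_1,\ldots,v_M)\in\mathbb{R}^M:\ v_1\ge-a_+,\ v_2\ge-a,\ \ldots,\ v_M\ge-a\}.$$ Let $\zeta_1:=\theta_1$ and, for $2\le i\le M$, let $\zeta_i:=\theta_i$ if either $\theta_{i-1}=\theta_i$ or $d_{i-1}(\theta_{i-1})=0$, and otherwise let $\zeta_i\in(\theta_i,\theta_{i-1})$. Suppose that there are finite constants $K_{i,j}$ such that for all $(v_1,\ldots,v_M)\in\mathcal{D}^M_a$, all $i\in\{1,\ldots,M\}$ and all odd $j\in\{1,\ldots,d_{i-1}(\theta_{i-1})\vee d_i(\theta_i)\}$ $$\mathbb{E}\left[\left(V^{(i)}-v_i\right)^je^{\zeta_i(V^{(i)}-v_i)}\mid V^{(i)}>v_i\right]\le K_{i,j}.$$ Then there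 exist polynomials $P_i:\mathbb{R}^i\to\mathbb{R}$ of degrees $d_i(\theta_i)$, respectively, for $i\in\{1,\ldots,M\}$, with $P_i(v_1,\ldots,v_i)\ge0$ for all $1\le i\le M$ and $(v_1,\ldots,v_M)\in\mathcal{D}^M_a$, such that $$\gamma_M(v_1,\ldots,v_M):=\mathbf{1}_{\{(v_1,\ldots,v_M)\in\mathcal{D}^M_a\}}\left[1-\sum_{i=1}^MP_i(v_1,\ldots,v_i)e^{-\theta_iv_i}\right]$$ satisfies, for all $(v_1,\ldots,v_M)\in\operatorname{supp}(\gamma_M\vee0)$, $$\mathbb{E}\left[\mathbf{1}_{\{v_1\ge V^{(1)}\}}\,\gamma_M\left(\bigwedge_{1\le i\le2}(v_i-V^{(i)}),\ \ldots,\ \bigwedge_{M-1\le i\le M}(v_i-V^{(i)}),\ v_M-V^{(M)}\right)\right]\ge\gamma_M(v_1,\ldots,v_M).$$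
   Context: Notation: $a_+:=\max\{a,0\}$; $x\vee y:=\max\{x,y\}$; $\bigwedge$ denotes minimum, so in the last display the $j$-th argument of $\gamma_M$ is $\min\{v_j-V^{(j)},v_{j+1}-V^{(j+1)}\}$ for $1\le j\le M-1$ and the $M$-th is $v_M-V^{(M)}$; $\operatorname{supp}(\gamma_M\vee0):=\{v:\gamma_M(v)>0\}$. For $i=1$ set $d_0(\theta_0):=0$ (so that there is no moment condition for $i=1$). The set $\{1,\ldots,0\}$ is empty. Conditional expectations are required to be bounded for those $v_i$ with $\mathbb{P}(V^{(i)}>v_i)>0$. In the paper $V^{(i)}\simeq Y^{(i)}-X$ with $X$ the inter-arrival time and $Y^{(i)}$ the service time at queue $i$ of a tandem of $M$ queues. *)

theory Defs
  imports "HOL-Probability.Probability" "HOL-Library.Poly_Mapping"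
begin

(* Mean with values in [-infinity, infinity]. The Bochner integral is 0 for non-integrable functions
   and would exclude the case E[X] = -infinity. Since infinity - infinity = infinity in ereal,
   ext_mean N X < 0 says that E[X^+] is finite and E[X] is negative, possibly -infinity. *)
definition ext_mean :: "'a measure \<Rightarrow> ('a \<Rightarrow> real) \<Rightarrow> ereal" where
  "ext_mean N X =
     enn2ereal (\<integral>\<^sup>+\<omega>. ennreal (X \<omega>) \<partial>N) - enn2ereal (\<integral>\<^sup>+\<omega>. ennreal (- X \<omega>) \<partial>N)"

lemma ext_mean_eq_integral:
  assumes "integrable N X"
  shows "ext_mean N X = ereal (integral\<^sup>L N X)"
proof -
  have "(\<integral>\<^sup>+\<omega>. ennreal (X \<omega>) \<partial>N) \<noteq> \<infinity>" "(\<integral>\<^sup>+\<omega>. ennreal (- X \<omega>) \<partial>N) \<noteq> \<infinity>"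
    using assms by (auto simp: real_integrable_def)
  then obtain p q where
    "(\<integral>\<^sup>+\<omega>. ennreal (X \<omega>) \<partial>N) = ennreal p" "0 \<le> p"
    "(\<integral>\<^sup>+\<omega>. ennreal (- X \<omega>) \<partial>N) = ennreal q" "0 \<le> q"
    by (metis ennreal_cases infinity_ennreal_def)
  then show ?thesis
    using assms by (simp add: ext_mean_def real_lebesgue_integral_def enn2ereal_ennreal)
qed

definition exp_moment :: "'a measure \<Rightarrow> ('a \<Rightarrow> real) \<Rightarrow> real \<Rightarrow> ennreal" where
  "exp_moment N X r = (\<integral>\<^sup>+\<omega>. ennreal (exp (r * X \<omega>)) \<partial>N)"

definition theta :: "'a measure \<Rightarrow> (nat \<Rightarrow> 'a \<Rightarrow> real) \<Rightarrow> nat \<Rightarrow> real" where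
  "theta N V i = Sup {r. 0 < r \<and> (\<forall>j\<in>{1..i}. exp_moment N (V j) r \<le> 1)}"

definition I_ind :: "'a measure \<Rightarrow> (nat \<Rightarrow> 'a \<Rightarrow> real) \<Rightarrow> nat \<Rightarrow> real \<Rightarrow> nat" where
  "I_ind N V i r = (if exp_moment N (V i) r = 1 then 1 else 0)"

(* The sum is empty for j \<le> 1; thus d_cnt N V 0 r = d_cnt N V 1 r = 0 for every r. *)
definition d_cnt :: "'a measure \<Rightarrow> (nat \<Rightarrow> 'a \<Rightarrow> real) \<Rightarrow> nat \<Rightarrow> real \<Rightarrow> nat" where
  "d_cnt N V j r = (\<Sum>k=2..j. I_ind N V k r)"

(* A vector (v_1, ..., v_M) is a function nat \<Rightarrow> real of which only the values at 1, ..., M are used. *)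
definition dom_D :: "nat \<Rightarrow> real \<Rightarrow> (nat \<Rightarrow> real) set" where
  "dom_D M a = {v. - max a 0 \<le> v 1 \<and> (\<forall>i\<in>{2..M}. - a \<le> v i)}"

(* Conditional expectation of a nonnegative quantity given X > x, an event of positive probability
   wherever this is used. Negative values of (X - x)^j lie outside the event, which has full
   measure under uniform_measure, so the truncation by ennreal loses nothing. *)
definition cond_excess_moment :: "'a measure \<Rightarrow> ('a \<Rightarrow> real) \<Rightarrow> real \<Rightarrow> real \<Rightarrow> nat \<Rightarrow> ennreal" where
  "cond_excess_moment N X z x j =
     (\<integral>\<^sup>+\<omega>. ennreal ((X \<omega> - x) ^ j * exp (z * (X \<omega> - x)))
        \<partial>uniform_measure N {\<omega>\<in>space N. X \<omega> > x})"

(* Real polynomials in variables indexed by nat: a finitely supported map from monomials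
   (finitely supported exponent functions) to coefficients. *)
type_synonym mvpoly = "(nat \<Rightarrow>\<^sub>0 nat) \<Rightarrow>\<^sub>0 real"

definition mv_eval :: "mvpoly \<Rightarrow> (nat \<Rightarrow> real) \<Rightarrow> real" where
  "mv_eval p v =
     (\<Sum>m\<in>Poly_Mapping.keys p. Poly_Mapping.lookup p m *
        (\<Prod>k\<in>Poly_Mapping.keys m. v k ^ Poly_Mapping.lookup m k))"

definition mv_vars :: "mvpoly \<Rightarrow> nat set" where
  "mv_vars p = (\<Union>m\<in>Poly_Mapping.keys p. Poly_Mapping.keys m)"

definition mon_degree :: "(nat \<Rightarrow>\<^sub>0 nat) \<Rightarrow> nat" where
  "mon_degree m = (\<Sum>k\<in>Poly_Mapping.keys m. Poly_Mapping.lookup m k)"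

(* Total degree exactly n; the zero polynomial has no degree. *)
definition mv_has_degree :: "mvpoly \<Rightarrow> nat \<Rightarrow> bool" where
  "mv_has_degree p n \<longleftrightarrow>
     (\<exists>m\<in>Poly_Mapping.keys p. mon_degree m = n) \<and> (\<forall>m\<in>Poly_Mapping.keys p. mon_degree m \<le> n)"

definition gamma_fn ::
    "nat \<Rightarrow> real \<Rightarrow> (nat \<Rightarrow> real) \<Rightarrow> (nat \<Rightarrow> mvpoly) \<Rightarrow> (nat \<Rightarrow> real) \<Rightarrow> real" where
  "gamma_fn M a th P v =
     indicator (dom_D M a) v * (1 - (\<Sum>i=1..M. mv_eval (P i) v * exp (- th i * v i)))"

definition shift_min :: "nat \<Rightarrow> (nat \<Rightarrow> real) \<Rightarrow> (nat \<Rightarrow> real) \<Rightarrow> nat \<Rightarrow> real" where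
  "shift_min M v x j = (if j < M then min (v j - x j) (v (Suc j) - x (Suc j)) else v j - x j)"

end

theory Submission
  imports Defs
begin

text \<open>
  Write \<open>\<theta> i = theta \<Omega> V i\<close> and \<open>n i = d_cnt \<Omega> V i (\<theta> i)\<close>. The polynomials can be taken in the last
  variable alone: \<open>P i v = c i * (v i + a + s i) ^ n i\<close> with \<open>c i \<ge> 1\<close> and \<open>s i \<ge> 1\<close>. Put
  \<open>f i x = c i * (x + a + s i) ^ n i * exp (- \<theta> i * x)\<close>, so that inside the domain \<open>\<gamma>\<close> is
  \<open>1 - (\<Sum>i=1..M. f i (v i))\<close>.

  After one step the \<open>i\<close>-th coordinate is a minimum of two of the numbers \<open>A i = v i - V i\<close>, and
  for a nonnegative function the value at a minimum of two points is at most the sum of the values.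
  Hence, inside the domain, the new sum is at most the sum of \<open>f 1 (A 1)\<close> and of
  \<open>f i (A i) + f (i - 1) (A i)\<close> over \<open>i = 2..M\<close>. Replace the \<open>i\<close>-th of the latter terms by \<open>1\<close>
  whenever \<open>A i < - a\<close>. As \<open>f 1 \<ge> 1\<close> on the negative numbers, every exit from the domain then makes
  the sum at least \<open>1\<close>, which is what the value \<open>0\<close> of \<open>\<gamma>\<close> outside the domain requires. So
  everything decouples (\<open>drift_inequality\<close>), and what is left is one estimate per coordinate:
  \<open>f i\<close> must exceed the mean of \<open>f i (x - V i)\<close> by enough to pay for the
  mean of \<open>f (i - 1) (x - V i)\<close> and for the exit probability (\<open>one_step_drift\<close>).

  To find this slack, move the factor \<open>exp (\<theta> i * V i)\<close> into the measure. With \<open>Q\<close> this tilted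
  measure, of mass at most one, and \<open>u = x + a + s\<close>, the question is how far the \<open>n\<close>-th moment of
  the positive part of \<open>u - V i\<close> stays below \<open>u ^ n\<close>. If the mass is less than one, then the gap is
  of order \<open>u ^ n\<close>, and it suffices to keep the degree of the previous function. If the mass is one,
  then \<open>V i\<close> has a positive mean under \<open>Q\<close>, the gap is of order \<open>u ^ (n - 1)\<close>, and the degree must
  increase by one (\<open>tilted_gap\<close>). This is why the degree counts the critical exponents. In both
  cases a large \<open>s\<close> makes the gap uniform in \<open>x\<close>, and a large \<open>c\<close> makes it as large as needed.
  If \<open>\<theta> i < \<theta> (i - 1)\<close>, then the previous function decays at a faster exponential rate and is
  bounded by a multiple of \<open>exp (- \<theta> i * x)\<close>, whatever its degree (\<open>poly_exp_dominated\<close>); this is why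
  the count may start again at a smaller exponent.

  The conditional moment bounds enter through their case \<open>j = 1\<close>: at a critical exponent they make
  \<open>V i * exp (\<theta> i * V i)\<close> integrable, which is what the mean of \<open>V i\<close> under \<open>Q\<close> needs.
\<close>

section \<open>Univariate polynomials as multivariate ones\<close>

definition uni_mvpoly :: "nat \<Rightarrow> real poly \<Rightarrow> mvpoly" where
  "uni_mvpoly i p =
     (\<Sum>k\<le>degree p. Poly_Mapping.single (Poly_Mapping.single i k) (coeff p k))"

lemma lookup_uni_mvpoly:
  "Poly_Mapping.lookup (uni_mvpoly i p) (Poly_Mapping.single i k) = coeff p k"
proof -
  have "Poly_Mapping.lookup (uni_mvpoly i p) (Poly_Mapping.single i k) =
      (\<Sum>l\<le>degree p. if l = k then coeff p l else 0)"
    unfolding uni_mvpoly_def lookup_sum lookup_single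
    by (intro sum.cong) (auto simp: when_def dest: injD[OF inj_single])
  also have "\<dots> = coeff p k"
    by (auto simp: coeff_eq_0)
  finally show ?thesis .
qed

lemma keys_uni_mvpoly:
  "Poly_Mapping.keys (uni_mvpoly i p) \<subseteq> Poly_Mapping.single i ` {..degree p}"
proof -
  have "Poly_Mapping.keys (uni_mvpoly i p)
      \<subseteq> (\<Union>k\<le>degree p. Poly_Mapping.keys (Poly_Mapping.single (Poly_Mapping.single i k) (coeff p k)))"
    unfolding uni_mvpoly_def by (rule keys_sum)
  also have "\<dots> \<subseteq> Poly_Mapping.single i ` {..degree p}"
    by (auto split: if_splits)
  finally show ?thesis .
qed

lemma mv_eval_uni_mvpoly: "mv_eval (uni_mvpoly i p) v = poly p (v i)"
proof -
  have "mv_eval (uni_mvpoly i p) v =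
      (\<Sum>m\<in>Poly_Mapping.single i ` {..degree p}. Poly_Mapping.lookup (uni_mvpoly i p) m *
        (\<Prod>k\<in>Poly_Mapping.keys m. v k ^ Poly_Mapping.lookup m k))"
    unfolding mv_eval_def
    by (rule sum.mono_neutral_left[OF _ keys_uni_mvpoly]) (auto simp: in_keys_iff)
  also have "\<dots> = (\<Sum>l\<le>degree p. coeff p l * v i ^ l)"
    by (subst sum.reindex)
      (auto simp: inj_on_def lookup_uni_mvpoly dest: injD[OF inj_single] intro!: sum.cong)
  finally show ?thesis
    by (simp add: poly_altdef)
qed

lemma mv_vars_uni_mvpoly: "mv_vars (uni_mvpoly i p) \<subseteq> {i}"
  unfolding mv_vars_def using keys_uni_mvpoly[of i p] by (force split: if_splits)

lemma mv_has_degree_uni_mvpoly: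
  assumes "p \<noteq> 0"
  shows "mv_has_degree (uni_mvpoly i p) (degree p)"
proof -
  have deg: "mon_degree (Poly_Mapping.single i k) = k" for k
    by (simp add: mon_degree_def)
  have "Poly_Mapping.single i (degree p) \<in> Poly_Mapping.keys (uni_mvpoly i p)"
    using assms by (simp add: in_keys_iff lookup_uni_mvpoly)
  then show ?thesis
    unfolding mv_has_degree_def using keys_uni_mvpoly[of i p] deg by force
qed

section \<open>Inequalities for exponentials\<close>

lemma exp_gt_one_plus:
  fixes x :: real
  assumes "x \<noteq> 0"
  shows "1 + x < exp x"
proof -
  have "1 + x \<le> exp x" by (rule exp_ge_add_one_self)
  moreover have "1 + x \<noteq> exp x"
  proof
    assume e: "1 + x = exp x"
    then have "ln (exp x) = exp x - 1" by simp
    then have "exp x = 1" using ln_eq_minus_one[of "exp x"] by simp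
    then show False using assms by simp
  qed
  ultimately show ?thesis by (simp add: less_le)
qed

lemma exp_convex_le:
  fixes l u :: real
  assumes "0 < l" "l \<le> 1"
  shows "exp (l * u) \<le> 1 - l + l * exp u"
  using convex_onD[OF exp_convex, of l 0 u] assms by simp

lemma power_le_const_mult_exp:
  fixes b :: real
  assumes "0 < b"
  obtains C where "0 < C" "\<And>u. 0 \<le> u \<Longrightarrow> (1 + u) ^ k \<le> C * exp (b * u)"
proof (cases "k = 0")
  case True
  then show ?thesis using assms by (intro that[of 1]) auto
next
  case False
  define C where "C = (real k / b) ^ k * exp b"
  have "(1 + u) ^ k \<le> C * exp (b * u)" if "0 \<le> u" for u
  proof -
    have "b * (1 + u) / k \<le> exp (b * (1 + u) / k)"
      using exp_ge_add_one_self[of "b * (1 + u) / k"] by linarith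
    then have "(b * (1 + u) / k) ^ k \<le> exp (b * (1 + u) / k) ^ k"
      using assms that by (intro power_mono) auto
    also have "\<dots> = exp (b * (1 + u))"
      using False by (simp add: exp_of_nat_mult[symmetric])
    finally have "(real k / b) ^ k * (b * (1 + u) / k) ^ k \<le> (real k / b) ^ k * exp (b * (1 + u))"
      using assms by (intro mult_left_mono) auto
    moreover have "real k / b * (b * (1 + u) / k) = 1 + u"
      using assms False by simp
    ultimately show ?thesis
      unfolding C_def by (simp only: power_mult_distrib[symmetric] exp_add distrib_left) (simp add: mult_ac)
  qed
  moreover have "0 < C" using assms False by (simp add: C_def)
  ultimately show ?thesis by (rule that[rotated])
qed

section \<open>Moments of the shortfall below a high level\<close>

text \<open>The factor on the right depends on \<open>t\<close> through \<open>t ^ n\<close> only, and tends to \<open>t ^ n\<close> when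
  \<open>s\<close> becomes large. This gives domination and uniformity in \<open>t \<ge> s\<close> at the same time.\<close>
lemma shortfall_power_le:
  fixes x s t :: real
  assumes "0 < s" "s \<le> t"
  shows "max (t - x) 0 ^ n \<le> t ^ n * (1 + max (- x) 0 / s) ^ n"
proof -
  have "max (- x) 0 * 1 \<le> max (- x) 0 * (t / s)"
    using assms by (intro mult_left_mono) auto
  then have "t + max (- x) 0 \<le> t * (1 + max (- x) 0 / s)"
    by (simp add: algebra_simps)
  moreover have "max (t - x) 0 \<le> t + max (- x) 0"
    using assms by auto
  ultimately have "max (t - x) 0 \<le> t * (1 + max (- x) 0 / s)"
    by linarith
  then show ?thesis
    unfolding power_mult_distrib[symmetric] by (intro power_mono) auto
qed

lemma integrable_shortfall_power:
  assumes [measurable]: "X \<in> borel_measurable Q"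
    and mom: "\<And>k. integrable Q (\<lambda>\<omega>. (1 + max (- X \<omega>) 0) ^ k)"
    and "1 \<le> (t :: real)"
  shows "integrable Q (\<lambda>\<omega>. max (t - X \<omega>) 0 ^ n)"
proof (rule Bochner_Integration.integrable_bound)
  show "integrable Q (\<lambda>\<omega>. t ^ n * (1 + max (- X \<omega>) 0) ^ n)"
    using mom by auto
  show "AE \<omega> in Q. norm (max (t - X \<omega>) 0 ^ n) \<le> norm (t ^ n * (1 + max (- X \<omega>) 0) ^ n)"
    using shortfall_power_le[of 1 t] assms(3) by (auto simp: power_mult_distrib)
qed auto

text \<open>Divided by \<open>t ^ n\<close>, the shortfall moment is at most the integral of the factor
  in \<open>shortfall_power_le\<close>, which converges to the total mass of \<open>Q\<close> by dominated convergence.\<close>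
lemma gap_subcritical:
  fixes X :: "'a \<Rightarrow> real"
  assumes "finite_measure Q" and [measurable]: "X \<in> borel_measurable Q"
    and mom: "\<And>k. integrable Q (\<lambda>\<omega>. (1 + max (- X \<omega>) 0) ^ k)"
    and mass: "measure Q (space Q) < 1"
  shows "\<exists>s\<ge>1. \<exists>\<delta>>0. \<forall>t\<ge>s. (\<integral>\<omega>. max (t - X \<omega>) 0 ^ n \<partial>Q) \<le> t ^ n - \<delta> * t ^ n"
proof -
  interpret finite_measure Q by fact
  define Y where "Y k \<omega> = (1 + max (- X \<omega>) 0 / real (Suc k)) ^ n" for k \<omega>
  have Y_le: "norm (Y k \<omega>) \<le> (1 + max (- X \<omega>) 0) ^ n" for k \<omega>
  proof -
    have "max (- X \<omega>) 0 / real (Suc k) \<le> max (- X \<omega>) 0 / 1"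
      by (intro divide_left_mono) auto
    then show ?thesis
      unfolding Y_def by (auto simp: power_abs[symmetric] intro!: power_mono)
  qed
  have Y_lim: "(\<lambda>k. Y k \<omega>) \<longlonglongrightarrow> 1" for \<omega>
  proof -
    have "(\<lambda>k. (1 + max (- X \<omega>) 0 * inverse (real (Suc k))) ^ n) \<longlonglongrightarrow> (1 + max (- X \<omega>) 0 * 0) ^ n"
      by (intro tendsto_intros LIMSEQ_inverse_real_of_nat)
    then show ?thesis by (simp add: Y_def divide_inverse)
  qed
  have [measurable]: "Y k \<in> borel_measurable Q" for k
    unfolding Y_def by measurable
  have "(\<lambda>k. integral\<^sup>L Q (Y k)) \<longlonglongrightarrow> (\<integral>\<omega>. 1 \<partial>Q)"
    by (rule integral_dominated_convergence[OF _ _ mom[of n]]) (use Y_lim Y_le in auto)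
  then have "eventually (\<lambda>k. integral\<^sup>L Q (Y k) < 1) sequentially"
    using mass by (intro order_tendstoD(2)[of _ "\<integral>\<omega>. 1 \<partial>Q"]) auto
  then obtain k where k: "integral\<^sup>L Q (Y k) < 1"
    by (auto simp: eventually_sequentially)
  have int_Y: "integrable Q (Y k)"
    by (rule Bochner_Integration.integrable_bound[OF mom[of n]]) (use Y_le in auto)
  have "(\<integral>\<omega>. max (t - X \<omega>) 0 ^ n \<partial>Q) \<le> t ^ n - (1 - integral\<^sup>L Q (Y k)) * t ^ n"
    if t: "real (Suc k) \<le> t" for t
  proof -
    have "max (t - X \<omega>) 0 ^ n \<le> t ^ n * Y k \<omega>" for \<omega>
      unfolding Y_def using t by (intro shortfall_power_le) auto
    then have "(\<integral>\<omega>. max (t - X \<omega>) 0 ^ n \<partial>Q) \<le> (\<integral>\<omega>. t ^ n * Y k \<omega> \<partial>Q)"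
      using t int_Y by (intro integral_mono integrable_shortfall_power mom) auto
    then show ?thesis by (simp add: algebra_simps)
  qed
  then show ?thesis
    using k by (intro exI[of _ "real (Suc k)"] conjI exI[of _ "1 - integral\<^sup>L Q (Y k)"]) auto
qed

text \<open>The distance of the shortfall power from \<open>t ^ n\<close>, in units of \<open>t ^ (n - 1)\<close>; see
  \<open>shortfall_power_eq_deficit\<close>. In these units it has the finite limit \<open>n * x\<close> as \<open>t\<close> grows.\<close>
definition deficit :: "nat \<Rightarrow> real \<Rightarrow> real \<Rightarrow> real" where
  "deficit n t x = t * (1 - max (1 - x / t) 0 ^ n)"

lemma shortfall_power_eq_deficit:
  assumes "0 < t" "0 < n"
  shows "max (t - x) 0 ^ n = t ^ n - t ^ (n - 1) * deficit n t x"
proof -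
  have "max (t - x) 0 = t * max (1 - x / t) 0"
    using assms by (auto simp: max_def field_simps)
  moreover have "t ^ n = t ^ (n - 1) * t"
    using assms by (simp add: power_eq_if mult.commute)
  ultimately show ?thesis
    by (simp add: deficit_def power_mult_distrib algebra_simps)
qed

text \<open>With \<open>G y = 1 - max (1 - y) 0 ^ n\<close> the deficit is \<open>t * G (x / t)\<close>. Since \<open>G\<close> is concave and
  \<open>G 0 \<ge> 0\<close>, we have \<open>G (l * y) \<ge> l * G y\<close> for \<open>l = s / t\<close>. Monotonicity turns a bound at one level
  into a bound that is uniform over all higher levels.\<close>
lemma deficit_mono:
  assumes "0 < s" "s \<le> t"
  shows "deficit n s x \<le> deficit n t x"
proof -
  define l where "l = s / t"
  define b where "b = max (1 - x / s) 0"
  have l: "0 < l" "l \<le> 1" using assms by (auto simp: l_def)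
  have b: "0 \<le> b" by (simp add: b_def)
  have "1 - x / t = (1 - l) + l * (1 - x / s)"
    using assms by (simp add: l_def field_simps)
  also have "\<dots> \<le> (1 - l) + l * b"
    using l by (intro add_left_mono mult_left_mono) (auto simp: b_def)
  finally have "max (1 - x / t) 0 \<le> (1 - l) + l * b"
    using l b by auto
  then have "max (1 - x / t) 0 ^ n \<le> ((1 - l) * 1 + l * b) ^ n"
    by (intro power_mono) auto
  also have "\<dots> \<le> (1 - l) * 1 ^ n + l * b ^ n"
  proof -
    have "convex_on {0..} (\<lambda>x::real. x ^ n)"
      by (cases "even n")
        (auto intro: convex_power_odd convex_on_subset[OF convex_power_even])
    from convex_onD[OF this, of l 1 b] show ?thesis
      using l b by simp
  qed
  finally have "t * (max (1 - x / t) 0 ^ n) \<le> t * ((1 - l) + l * b ^ n)"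
    using assms by (intro mult_left_mono) auto
  also have "\<dots> = t - s + s * b ^ n"
    using assms by (simp add: l_def field_simps)
  finally show ?thesis
    by (simp add: deficit_def b_def algebra_simps)
qed

text \<open>The integrable bound for dominated convergence as \<open>s\<close> grows. It is linear in \<open>x\<close> for
  positive \<open>x\<close>, so that a first moment on that side suffices.\<close>
lemma abs_deficit_le:
  assumes "1 \<le> s"
  shows "\<bar>deficit n s x\<bar> \<le> real n * (\<bar>x\<bar> * (1 + max (- x) 0) ^ n)"
proof -
  define u where "u = max (1 - x / s) 0"
  have u: "0 \<le> u" "u \<le> 1 + max (- x) 0"
  proof -
    have "- x / s \<le> max (- x) 0 / s" using assms by (intro divide_right_mono) auto
    also have "\<dots> \<le> max (- x) 0 / 1" using assms by (intro divide_left_mono) auto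
    finally show "u \<le> 1 + max (- x) 0" by (auto simp: u_def)
  qed (simp add: u_def)
  have "s * \<bar>1 - u\<bar> \<le> s * (\<bar>x\<bar> / s)"
    using assms by (intro mult_left_mono) (auto simp: u_def max_def abs_if field_simps)
  then have 1: "s * \<bar>1 - u\<bar> \<le> \<bar>x\<bar>" using assms by simp
  have "(\<Sum>i<n. u ^ i) \<le> (\<Sum>i<n. (1 + max (- x) 0) ^ n)"
  proof (rule sum_mono)
    fix i assume "i \<in> {..<n}"
    have "u ^ i \<le> (1 + max (- x) 0) ^ i" using u by (intro power_mono) auto
    also have "\<dots> \<le> (1 + max (- x) 0) ^ n"
      using \<open>i \<in> {..<n}\<close> by (intro power_increasing) auto
    finally show "u ^ i \<le> (1 + max (- x) 0) ^ n" .
  qed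
  then have 2: "(\<Sum>i<n. u ^ i) \<le> real n * (1 + max (- x) 0) ^ n" by simp
  have "deficit n s x = (s * (1 - u)) * (\<Sum>i<n. u ^ i)"
    by (simp add: deficit_def u_def[symmetric] one_diff_power_eq)
  then have "\<bar>deficit n s x\<bar> = (s * \<bar>1 - u\<bar>) * (\<Sum>i<n. u ^ i)"
    using assms u by (simp add: abs_mult sum_nonneg)
  also have "\<dots> \<le> \<bar>x\<bar> * (real n * (1 + max (- x) 0) ^ n)"
    using 1 2 u assms by (intro mult_mono) (auto intro: sum_nonneg)
  finally show ?thesis by (simp add: algebra_simps)
qed

lemma deficit_tendsto: "(\<lambda>k. deficit n (real (Suc k)) x) \<longlonglongrightarrow> real n * x"
proof -
  have "(\<lambda>k. x * (\<Sum>i<n. (1 - x * inverse (real (Suc k))) ^ i)) \<longlonglongrightarrow> x * (\<Sum>i<n. (1 - x * 0) ^ i)"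
    by (intro tendsto_intros LIMSEQ_inverse_real_of_nat)
  moreover have "eventually (\<lambda>k. x * (\<Sum>i<n. (1 - x * inverse (real (Suc k))) ^ i)
      = deficit n (real (Suc k)) x) sequentially"
  proof -
    obtain N where N: "x < real N" using reals_Archimedean2 by blast
    show ?thesis
    proof (rule eventually_sequentiallyI[of N])
      fix k assume "N \<le> k"
      define s where "s = real (Suc k)"
      have s: "x < s" "0 < s" using N \<open>N \<le> k\<close> by (auto simp: s_def)
      have "max (1 - x / s) 0 = 1 - x / s" using s by (auto simp: field_simps)
      then have "deficit n s x = s * (x / s * (\<Sum>i<n. (1 - x / s) ^ i))"
        by (simp add: deficit_def one_diff_power_eq)
      then show "x * (\<Sum>i<n. (1 - x * inverse (real (Suc k))) ^ i) = deficit n (real (Suc k)) x"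
        using s unfolding s_def[symmetric] by (simp add: divide_inverse)
    qed
  qed
  ultimately show ?thesis
    by (auto intro: Lim_transform_eventually simp: mult.commute)
qed

text \<open>By dominated convergence the mean deficit at level \<open>s\<close> tends to \<open>Suc n\<close> times the mean of \<open>X\<close>,
  hence is positive at some level, and it does not decrease at higher levels.\<close>
lemma gap_critical:
  fixes X :: "'a \<Rightarrow> real"
  assumes "prob_space Q" and [measurable]: "X \<in> borel_measurable Q"
    and mom: "\<And>k. integrable Q (\<lambda>\<omega>. (1 + max (- X \<omega>) 0) ^ k)"
    and X: "integrable Q X" and drift: "0 < integral\<^sup>L Q X"
  shows "\<exists>s\<ge>1. \<exists>\<delta>>0. \<forall>t\<ge>s. (\<integral>\<omega>. max (t - X \<omega>) 0 ^ Suc n \<partial>Q) \<le> t ^ Suc n - \<delta> * t ^ n"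
proof -
  interpret prob_space Q by fact
  define n' where "n' = Suc n"
  define B where "B \<omega> = real n' * (\<bar>X \<omega>\<bar> * (1 + max (- X \<omega>) 0) ^ n')" for \<omega>
  have [measurable]: "(\<lambda>\<omega>. deficit n' s (X \<omega>)) \<in> borel_measurable Q" for s
    unfolding deficit_def by measurable
  have int_B: "integrable Q B"
    unfolding B_def
  proof (rule integrable_mult_right, rule Bochner_Integration.integrable_bound)
    show "integrable Q (\<lambda>\<omega>. \<bar>X \<omega>\<bar> + (1 + max (- X \<omega>) 0) ^ Suc n')"
      using X mom[of "Suc n'"] by (intro Bochner_Integration.integrable_add integrable_abs) auto
    have "\<bar>x\<bar> * (1 + max (- x) 0) ^ n' \<le> \<bar>x\<bar> + (1 + max (- x) 0) ^ Suc n'" for x :: real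
    proof (cases "0 \<le> x")
      case False
      then have "\<bar>x\<bar> * (1 + max (- x) 0) ^ n' \<le> (1 + max (- x) 0) * (1 + max (- x) 0) ^ n'"
        by (intro mult_right_mono) auto
      then show ?thesis unfolding power_Suc using abs_ge_zero[of x] by linarith
    qed (simp add: max_def)
    then show "AE \<omega> in Q. norm (\<bar>X \<omega>\<bar> * (1 + max (- X \<omega>) 0) ^ n')
        \<le> norm (\<bar>X \<omega>\<bar> + (1 + max (- X \<omega>) 0) ^ Suc n')"
      by (auto simp: abs_mult abs_of_nonneg simp del: power_Suc)
  qed auto
  have bound: "norm (deficit n' (real (Suc k)) (X \<omega>)) \<le> B \<omega>" for k \<omega>
    unfolding B_def real_norm_def by (rule abs_deficit_le) auto
  have "(\<lambda>k. \<integral>\<omega>. deficit n' (real (Suc k)) (X \<omega>) \<partial>Q) \<longlonglongrightarrow> (\<integral>\<omega>. real n' * X \<omega> \<partial>Q)"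
    by (rule integral_dominated_convergence[OF _ _ int_B]) (use deficit_tendsto bound in auto)
  moreover have "0 < (\<integral>\<omega>. real n' * X \<omega> \<partial>Q)"
    using drift by (simp add: n'_def)
  ultimately have "eventually (\<lambda>k. 0 < (\<integral>\<omega>. deficit n' (real (Suc k)) (X \<omega>) \<partial>Q)) sequentially"
    by (rule order_tendstoD(1))
  then obtain k where k: "0 < (\<integral>\<omega>. deficit n' (real (Suc k)) (X \<omega>) \<partial>Q)"
    by (auto simp: eventually_sequentially)
  define s where "s = real (Suc k)"
  have int_D: "integrable Q (\<lambda>\<omega>. deficit n' s (X \<omega>))"
    by (rule Bochner_Integration.integrable_bound[OF int_B]) (use bound in \<open>auto simp: s_def intro: order_trans[OF _ abs_ge_self]\<close>)
  have "(\<integral>\<omega>. max (t - X \<omega>) 0 ^ n' \<partial>Q) \<le> t ^ n' - (\<integral>\<omega>. deficit n' s (X \<omega>) \<partial>Q) * t ^ n"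
    if t: "s \<le> t" for t
  proof -
    have t1: "1 \<le> t" using t by (simp add: s_def)
    have "max (t - x) 0 ^ n' \<le> t ^ n' - t ^ n * deficit n' s x" for x
      using shortfall_power_eq_deficit[of t n' x] deficit_mono[of s t n' x] t t1
      by (auto simp: n'_def s_def intro!: mult_left_mono simp del: power_Suc)
    then have "(\<integral>\<omega>. max (t - X \<omega>) 0 ^ n' \<partial>Q) \<le> (\<integral>\<omega>. t ^ n' - t ^ n * deficit n' s (X \<omega>) \<partial>Q)"
      using t1 int_D by (intro integral_mono integrable_shortfall_power mom) auto
    also have "\<dots> = t ^ n' - (\<integral>\<omega>. deficit n' s (X \<omega>) \<partial>Q) * t ^ n"
      using int_D by (simp add: prob_space)
    finally show ?thesis .
  qed
  then show ?thesis
    using k unfolding n'_def s_def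
    by (intro exI[of _ "real (Suc k)"] conjI exI[of _ "\<integral>\<omega>. deficit (Suc n) (real (Suc k)) (X \<omega>) \<partial>Q"]) auto
qed

section \<open>Exponential moments that do not exceed one\<close>

lemma exp_moment_le_1_downward:
  assumes "prob_space \<Omega>" and [measurable]: "X \<in> borel_measurable \<Omega>"
    and "exp_moment \<Omega> X t \<le> 1" "0 < r" "r \<le> t"
  shows "exp_moment \<Omega> X r \<le> 1"
proof -
  interpret prob_space \<Omega> by fact
  define l where "l = r / t"
  have l: "0 < l" "l \<le> 1" "r = l * t" using assms by (auto simp: l_def)
  have "exp_moment \<Omega> X r \<le> (\<integral>\<^sup>+\<omega>. ennreal (1 - l) + ennreal l * ennreal (exp (t * X \<omega>)) \<partial>\<Omega>)"
    unfolding exp_moment_def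
  proof (intro nn_integral_mono)
    fix \<omega>
    have "exp (r * X \<omega>) \<le> (1 - l) + l * exp (t * X \<omega>)"
      using exp_convex_le[OF l(1,2), of "t * X \<omega>"] l(3) by (simp add: mult.assoc)
    then show "ennreal (exp (r * X \<omega>)) \<le> ennreal (1 - l) + ennreal l * ennreal (exp (t * X \<omega>))"
      using l by (simp add: ennreal_mult[symmetric] ennreal_plus[symmetric] ennreal_leI del: ennreal_plus)
  qed
  also have "\<dots> = ennreal (1 - l) + ennreal l * exp_moment \<Omega> X t"
    by (subst nn_integral_add) (auto simp: nn_integral_cmult emeasure_space_1 exp_moment_def)
  also have "\<dots> \<le> ennreal (1 - l) + ennreal l * 1"
    using assms by (intro add_left_mono mult_left_mono) auto
  also have "\<dots> = 1"
    using l by (simp add: ennreal_plus[symmetric] del: ennreal_plus)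
  finally show ?thesis .
qed

lemma exp_moment_le_1_integrable:
  assumes [measurable]: "X \<in> borel_measurable \<Omega>" and "exp_moment \<Omega> X t \<le> 1"
  shows "integrable \<Omega> (\<lambda>\<omega>. exp (t * X \<omega>))"
    and "exp_moment \<Omega> X t = ennreal (\<integral>\<omega>. exp (t * X \<omega>) \<partial>\<Omega>)"
proof -
  show *: "integrable \<Omega> (\<lambda>\<omega>. exp (t * X \<omega>))"
    using assms(2) unfolding exp_moment_def
    by (intro integrableI_nonneg) (auto simp: less_top[symmetric] top_unique)
  show "exp_moment \<Omega> X t = ennreal (\<integral>\<omega>. exp (t * X \<omega>) \<partial>\<Omega>)"
    unfolding exp_moment_def by (intro nn_integral_eq_integral *) auto
qed

lemma not_AE_zero_if_pos:
  assumes "prob_space \<Omega>" and [measurable]: "X \<in> borel_measurable \<Omega>"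
    and "0 < measure \<Omega> {\<omega>\<in>space \<Omega>. X \<omega> > (0::real)}"
  shows "\<not> (AE \<omega> in \<Omega>. X \<omega> \<le> 0)"
proof
  interpret prob_space \<Omega> by fact
  assume "AE \<omega> in \<Omega>. X \<omega> \<le> 0"
  then have "AE \<omega> in \<Omega>. \<not> X \<omega> > 0" by (auto simp: not_less)
  then have "prob {\<omega>\<in>space \<Omega>. X \<omega> > 0} = 0"
    by (subst prob_eq_0) auto
  with assms(3) show False by simp
qed

text \<open>The derivative at \<open>t\<close> of the convex function \<open>exp_moment \<Omega> X\<close>, which has the value \<open>1\<close> at both \<open>0\<close>
  and \<open>t\<close>. The proof integrates \<open>exp y * y > exp y - 1\<close> for \<open>y = t * X \<noteq> 0\<close>.\<close>
lemma tilted_drift_pos: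
  assumes "prob_space \<Omega>" and [measurable]: "X \<in> borel_measurable \<Omega>"
    and pos: "0 < measure \<Omega> {\<omega>\<in>space \<Omega>. X \<omega> > 0}"
    and t: "0 < t" and one: "exp_moment \<Omega> X t = 1"
    and int: "integrable \<Omega> (\<lambda>\<omega>. exp (t * X \<omega>) * X \<omega>)"
  shows "0 < (\<integral>\<omega>. exp (t * X \<omega>) * X \<omega> \<partial>\<Omega>)"
proof -
  interpret prob_space \<Omega> by fact
  note e = exp_moment_le_1_integrable[OF assms(2), of t, unfolded one, OF order.refl]
  have e1: "(\<integral>\<omega>. exp (t * X \<omega>) \<partial>\<Omega>) = 1"
    using e(2) by (metis ennreal_eq_1)
  define g where "g \<omega> = t * (exp (t * X \<omega>) * X \<omega>) - exp (t * X \<omega>) + 1" for \<omega>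
  have g_eq: "g \<omega> = exp (t * X \<omega>) * (exp (- (t * X \<omega>)) - (1 + - (t * X \<omega>)))" for \<omega>
    by (simp add: g_def algebra_simps flip: exp_add)
  have g: "0 \<le> g \<omega>" "X \<omega> \<noteq> 0 \<Longrightarrow> 0 < g \<omega>" for \<omega>
    unfolding g_eq using exp_ge_add_one_self[of "- (t * X \<omega>)"] exp_gt_one_plus[of "- (t * X \<omega>)"] t
    by (auto intro!: mult_nonneg_nonneg mult_pos_pos simp del: exp_ge_add_one_self)
  have int_g: "integrable \<Omega> g" unfolding g_def using e(1) int by auto
  have eq: "integral\<^sup>L \<Omega> g = t * (\<integral>\<omega>. exp (t * X \<omega>) * X \<omega> \<partial>\<Omega>)"
    unfolding g_def using e(1) int by (simp add: prob_space e1)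
  have "0 \<le> integral\<^sup>L \<Omega> g" using g by (intro integral_nonneg_AE) auto
  moreover have "integral\<^sup>L \<Omega> g \<noteq> 0"
  proof
    assume "integral\<^sup>L \<Omega> g = 0"
    then have "AE \<omega> in \<Omega>. g \<omega> = 0"
      using integral_nonneg_eq_0_iff_AE[OF int_g] g by auto
    then have "AE \<omega> in \<Omega>. X \<omega> \<le> 0"
    proof (rule eventually_mono)
      show "X \<omega> \<le> 0" if "g \<omega> = 0" for \<omega>
        using g(2)[of \<omega>] that by (cases "X \<omega> = 0") auto
    qed
    with not_AE_zero_if_pos[OF assms(1,2) pos] show False by simp
  qed
  ultimately have "0 < t * (\<integral>\<omega>. exp (t * X \<omega>) * X \<omega> \<partial>\<Omega>)"
    unfolding eq by linarith
  then show ?thesis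
    using t by (rule zero_less_mult_pos)
qed

lemma ext_mean_neg_imp_less:
  assumes "ext_mean N X < 0"
  shows "(\<integral>\<^sup>+\<omega>. ennreal (X \<omega>) \<partial>N) < (\<integral>\<^sup>+\<omega>. ennreal (- X \<omega>) \<partial>N)"
proof -
  have "p < q" if "enn2ereal p - enn2ereal q < 0" for p q :: ennreal
    using that
    by (cases p; cases q) (auto simp: enn2ereal_ennreal ennreal_less_iff)
  then show ?thesis using assms unfolding ext_mean_def by blast
qed

text \<open>The quotients \<open>(exp (r * X) - 1) / r\<close> tend to \<open>X\<close> as \<open>r\<close> tends to \<open>0\<close>. Their positive parts
  converge in mean, being dominated by the finite exponential moment; for the negative parts Fatou's
  lemma gives a lower bound, which also covers a mean of minus infinity. As the mean of \<open>X\<close> is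
  negative, the negative part of the quotient eventually outweighs the positive one.\<close>
lemma exists_exp_moment_le_1:
  assumes "prob_space \<Omega>" and [measurable]: "X \<in> borel_measurable \<Omega>"
    and mean: "ext_mean \<Omega> X < 0" and mgf: "0 < b" "exp_moment \<Omega> X b < \<infinity>"
  shows "\<exists>r>0. exp_moment \<Omega> X r \<le> 1"
proof -
  interpret prob_space \<Omega> by fact
  define r where "r k = b * inverse (real (Suc k))" for k
  have r: "0 < r k" "r k \<le> b" for k
    using mgf by (auto simp: r_def field_simps)
  have r_lim: "r \<longlonglongrightarrow> 0"
    using tendsto_mult[OF tendsto_const[of b] LIMSEQ_inverse_real_of_nat] by (simp add: r_def[abs_def])
  have quot_lim: "(\<lambda>k. (exp (r k * x) - 1) / r k) \<longlonglongrightarrow> x" for x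
  proof -
    have "((\<lambda>h. exp (h * x)) has_real_derivative x) (at 0)"
      by (auto intro!: derivative_eq_intros)
    then have "((\<lambda>h. (exp (h * x) - 1) / h) \<longlongrightarrow> x) (at 0)"
      by (simp add: DERIV_def)
    moreover have "filterlim r (at 0) sequentially"
      using r_lim r by (auto simp: filterlim_at less_imp_neq[THEN not_sym])
    ultimately show ?thesis by (rule filterlim_compose)
  qed
  define up dn where "up k \<omega> = ennreal ((exp (r k * X \<omega>) - 1) / r k)"
    and "dn k \<omega> = ennreal (- ((exp (r k * X \<omega>) - 1) / r k))" for k \<omega>
  have [measurable]: "up k \<in> borel_measurable \<Omega>" "dn k \<in> borel_measurable \<Omega>" for k
    unfolding up_def dn_def by measurable
  have up_lim: "(\<lambda>k. up k \<omega>) \<longlonglongrightarrow> ennreal (X \<omega>)" and dn_lim: "(\<lambda>k. dn k \<omega>) \<longlonglongrightarrow> ennreal (- X \<omega>)" for \<omega>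
    unfolding up_def dn_def by (intro tendsto_ennrealI tendsto_minus quot_lim)+
  have up_bound: "up k \<omega> \<le> ennreal (1 / b) * ennreal (exp (b * X \<omega>))" for k \<omega>
  proof -
    define l where "l = r k / b"
    have l: "0 < l" "l \<le> 1" "r k = l * b" using r[of k] mgf by (auto simp: l_def)
    have "exp (r k * X \<omega>) - 1 \<le> l * exp (b * X \<omega>)"
      using exp_convex_le[OF l(1,2), of "b * X \<omega>"] l by (simp add: mult.assoc)
    then have "(exp (r k * X \<omega>) - 1) / r k \<le> l * exp (b * X \<omega>) / r k"
      using r[of k] by (intro divide_right_mono) auto
    also have "\<dots> = 1 / b * exp (b * X \<omega>)"
      using l mgf by simp
    finally show ?thesis
      unfolding up_def using mgf by (simp add: ennreal_mult[symmetric] ennreal_leI)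
  qed
  have bound_fin: "(\<integral>\<^sup>+\<omega>. ennreal (1 / b) * ennreal (exp (b * X \<omega>)) \<partial>\<Omega>) < \<infinity>"
    using mgf by (simp add: nn_integral_cmult exp_moment_def ennreal_mult_less_top)
  have up_int: "(\<lambda>k. integral\<^sup>N \<Omega> (up k)) \<longlonglongrightarrow> (\<integral>\<^sup>+\<omega>. ennreal (X \<omega>) \<partial>\<Omega>)"
    by (rule nn_integral_dominated_convergence[OF _ _ _ _ bound_fin])
      (use up_bound up_lim in auto)
  have dn_int: "(\<integral>\<^sup>+\<omega>. ennreal (- X \<omega>) \<partial>\<Omega>) \<le> liminf (\<lambda>k. integral\<^sup>N \<Omega> (dn k))"
  proof -
    have "(\<integral>\<^sup>+\<omega>. ennreal (- X \<omega>) \<partial>\<Omega>) = (\<integral>\<^sup>+\<omega>. liminf (\<lambda>k. dn k \<omega>) \<partial>\<Omega>)"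
      using dn_lim by (intro nn_integral_cong lim_imp_Liminf[symmetric]) auto
    also have "\<dots> \<le> liminf (\<lambda>k. integral\<^sup>N \<Omega> (dn k))"
      by (intro nn_integral_liminf) auto
    finally show ?thesis .
  qed
  obtain z where z: "(\<integral>\<^sup>+\<omega>. ennreal (X \<omega>) \<partial>\<Omega>) < z" "z < (\<integral>\<^sup>+\<omega>. ennreal (- X \<omega>) \<partial>\<Omega>)"
    using dense[OF ext_mean_neg_imp_less[OF mean]] by blast
  have "eventually (\<lambda>k. integral\<^sup>N \<Omega> (up k) < z) sequentially"
    using order_tendstoD(2)[OF up_int z(1)] .
  moreover have "eventually (\<lambda>k. z < integral\<^sup>N \<Omega> (dn k)) sequentially"
    using less_LiminfD[OF less_le_trans[OF z(2) dn_int]] .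
  ultimately have "eventually (\<lambda>k. integral\<^sup>N \<Omega> (up k) < z \<and> z < integral\<^sup>N \<Omega> (dn k)) sequentially"
    by (rule eventually_conj)
  then obtain k where k: "integral\<^sup>N \<Omega> (up k) < z" "z < integral\<^sup>N \<Omega> (dn k)"
    by (auto simp: eventually_sequentially)
  \<comment> \<open>The identity \<open>exp + r * negative part = 1 + r * positive part\<close> avoids subtraction in \<open>ennreal\<close>.\<close>
  have split: "ennreal (exp (r k * X \<omega>)) + ennreal (r k) * dn k \<omega> = 1 + ennreal (r k) * up k \<omega>" for \<omega>
  proof (cases "0 \<le> X \<omega>")
    case True
    then have "1 \<le> exp (r k * X \<omega>)" using r[of k] by simp
    then show ?thesis
      using r[of k] unfolding up_def dn_def
      by (subst (2) ennreal_neg)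
        (auto simp: ennreal_mult[symmetric] ennreal_1[symmetric] ennreal_plus[symmetric] simp del: ennreal_1 ennreal_plus)
  next
    case False
    then have "exp (r k * X \<omega>) \<le> 1" using r[of k] by (auto simp: mult_le_0_iff)
    then show ?thesis
      using r[of k] unfolding up_def dn_def
      by (subst (3) ennreal_neg)
        (auto simp: ennreal_mult[symmetric] ennreal_1[symmetric] ennreal_plus[symmetric] divide_nonpos_pos simp del: ennreal_1 ennreal_plus)
  qed
  have "exp_moment \<Omega> X (r k) + ennreal (r k) * integral\<^sup>N \<Omega> (dn k)
      = (\<integral>\<^sup>+\<omega>. ennreal (exp (r k * X \<omega>)) + ennreal (r k) * dn k \<omega> \<partial>\<Omega>)"
    by (simp add: exp_moment_def nn_integral_add nn_integral_cmult)
  also have "\<dots> = 1 + ennreal (r k) * integral\<^sup>N \<Omega> (up k)"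
    unfolding split by (simp add: nn_integral_add nn_integral_cmult emeasure_space_1)
  finally have eq: "exp_moment \<Omega> X (r k) + ennreal (r k) * integral\<^sup>N \<Omega> (dn k)
      = 1 + ennreal (r k) * integral\<^sup>N \<Omega> (up k)" .
  have "exp_moment \<Omega> X (r k) + ennreal (r k) * integral\<^sup>N \<Omega> (up k)
      \<le> exp_moment \<Omega> X (r k) + ennreal (r k) * integral\<^sup>N \<Omega> (dn k)"
    using k by (intro add_left_mono mult_left_mono) auto
  also note eq
  finally have "ennreal (r k) * integral\<^sup>N \<Omega> (up k) + exp_moment \<Omega> X (r k)
      \<le> ennreal (r k) * integral\<^sup>N \<Omega> (up k) + 1"
    by (simp add: add.commute)
  moreover have "ennreal (r k) * integral\<^sup>N \<Omega> (up k) < \<infinity>"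
    using less_le_trans[OF k(1) top_greatest] by (simp add: ennreal_mult_less_top)
  ultimately have "exp_moment \<Omega> X (r k) \<le> 1"
    by (auto simp: ennreal_add_left_cancel_le)
  then show ?thesis using r by blast
qed

text \<open>Fatou's lemma; it applies even if the exponential moment is infinite beyond \<open>t\<close>.\<close>
lemma exp_moment_le_1_limit:
  assumes [measurable]: "X \<in> borel_measurable \<Omega>"
    and lim: "r \<longlonglongrightarrow> t" and le: "\<And>k. exp_moment \<Omega> X (r k) \<le> 1"
  shows "exp_moment \<Omega> X t \<le> 1"
proof -
  have "exp_moment \<Omega> X t = (\<integral>\<^sup>+\<omega>. liminf (\<lambda>k. ennreal (exp (r k * X \<omega>))) \<partial>\<Omega>)"
    unfolding exp_moment_def
    by (intro nn_integral_cong lim_imp_Liminf[symmetric] tendsto_ennrealI tendsto_intros lim) auto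
  also have "\<dots> \<le> liminf (\<lambda>k. exp_moment \<Omega> X (r k))"
    unfolding exp_moment_def by (intro nn_integral_liminf) auto
  also have "\<dots> \<le> limsup (\<lambda>k. 1)"
    using le by (intro order_trans[OF Liminf_le_Limsup] Limsup_mono) auto
  also have "\<dots> = 1" by (simp add: Limsup_const)
  finally show ?thesis .
qed

text \<open>From \<open>exp (r * X) \<ge> r * X\<close>, a moment of at most one bounds \<open>r\<close> by the inverse of the mean of
  the positive part of \<open>X\<close>.\<close>
lemma exp_moment_le_1_bounded:
  assumes "prob_space \<Omega>" and [measurable]: "X \<in> borel_measurable \<Omega>"
    and pos: "0 < measure \<Omega> {\<omega>\<in>space \<Omega>. X \<omega> > 0}"
  obtains B where "\<And>r. 0 < r \<Longrightarrow> exp_moment \<Omega> X r \<le> 1 \<Longrightarrow> r \<le> B"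
proof -
  interpret prob_space \<Omega> by fact
  define p where "p = (\<integral>\<^sup>+\<omega>. ennreal (X \<omega>) \<partial>\<Omega>)"
  have "p \<noteq> 0"
  proof
    assume "p = 0"
    then have "AE \<omega> in \<Omega>. X \<omega> \<le> 0"
      unfolding p_def by (subst (asm) nn_integral_0_iff_AE) (auto simp: ennreal_eq_0_iff)
    with not_AE_zero_if_pos[OF assms(1,2) pos] show False by simp
  qed
  have rp: "ennreal r * p \<le> 1" if "0 < r" "exp_moment \<Omega> X r \<le> 1" for r
  proof -
    have "ennreal r * p = (\<integral>\<^sup>+\<omega>. ennreal (r * X \<omega>) \<partial>\<Omega>)"
      unfolding p_def using that(1) by (subst nn_integral_cmult[symmetric]) (auto simp: ennreal_mult')
    also have "\<dots> \<le> exp_moment \<Omega> X r"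
      unfolding exp_moment_def
      by (intro nn_integral_mono ennreal_leI) (use exp_ge_add_one_self in \<open>smt (verit)\<close>)
    finally show ?thesis using that by simp
  qed
  have "r \<le> 1 / enn2real p" if "0 < r" "exp_moment \<Omega> X r \<le> 1" for r
  proof -
    have "p \<noteq> \<infinity>" using rp[OF that] that by (auto simp: ennreal_mult_top top_unique)
    then obtain q where q: "p = ennreal q" "0 < q"
      using \<open>p \<noteq> 0\<close> by (cases p) (auto simp: ennreal_eq_0_iff less_le)
    then have "r * q \<le> 1"
      using rp[OF that] that by (simp add: ennreal_mult[symmetric] ennreal_le_1)
    then show ?thesis using q by (simp add: field_simps)
  qed
  then show ?thesis by (rule that)
qed

section \<open>The exponents of a tandem system\<close>

locale tandem =
  fixes \<Omega> :: "'a measure" and M :: nat and V :: "nat \<Rightarrow> 'a \<Rightarrow> real"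
  assumes prob: "prob_space \<Omega>"
    and meas [measurable]: "\<And>i. i \<in> {1..M} \<Longrightarrow> V i \<in> borel_measurable \<Omega>"
    and pos: "\<And>i. i \<in> {1..M} \<Longrightarrow> measure \<Omega> {\<omega>\<in>space \<Omega>. V i \<omega> > 0} > 0"
    and mean: "\<And>i. i \<in> {1..M} \<Longrightarrow> ext_mean \<Omega> (V i) < 0"
    and mgf: "\<And>i. i \<in> {1..M} \<Longrightarrow> \<exists>r>0. exp_moment \<Omega> (V i) r < \<infinity>"
begin

definition admissible :: "nat \<Rightarrow> real set" where
  "admissible i = {r. 0 < r \<and> (\<forall>j\<in>{1..i}. exp_moment \<Omega> (V j) r \<le> 1)}"

lemma theta_eq_Sup: "theta \<Omega> V i = Sup (admissible i)"
  by (simp add: theta_def admissible_def)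

lemma admissible_nonempty: "i \<le> M \<Longrightarrow> admissible i \<noteq> {}"
proof (induction i)
  case 0
  show ?case by (auto simp: admissible_def intro: exI[of _ 1])
next
  case (Suc i)
  then obtain r where r: "0 < r" "\<And>j. j \<in> {1..i} \<Longrightarrow> exp_moment \<Omega> (V j) r \<le> 1"
    by (auto simp: admissible_def)
  have i: "Suc i \<in> {1..M}" using Suc by auto
  obtain q where q: "0 < q" "exp_moment \<Omega> (V (Suc i)) q \<le> 1"
    using mgf[OF i] exists_exp_moment_le_1[OF prob meas[OF i] mean[OF i]] by blast
  have "exp_moment \<Omega> (V j) (min r q) \<le> 1" if "j \<in> {1..Suc i}" for j
  proof (cases "j = Suc i")
    case True
    then show ?thesis
      using q r(1) meas[OF i] by (auto intro: exp_moment_le_1_downward[OF prob _ q(2)])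
  next
    case False
    then show ?thesis
      using that q(1) r Suc.prems by (intro exp_moment_le_1_downward[OF prob meas r(2)]) auto
  qed
  then have "min r q \<in> admissible (Suc i)"
    using r(1) q(1) by (auto simp: admissible_def)
  then show ?case by blast
qed

lemma admissible_bdd:
  assumes "i \<in> {1..M}"
  shows "bdd_above (admissible i)"
proof -
  obtain B where "\<And>r. 0 < r \<Longrightarrow> exp_moment \<Omega> (V i) r \<le> 1 \<Longrightarrow> r \<le> B"
    using exp_moment_le_1_bounded[OF prob meas[OF assms] pos[OF assms]] by blast
  then show ?thesis
    using assms unfolding bdd_above_def admissible_def by (intro exI[of _ B]) auto
qed

lemma theta_pos:
  assumes "i \<in> {1..M}"
  shows "0 < theta \<Omega> V i"
proof -
  obtain r where "r \<in> admissible i" using admissible_nonempty[of i] assms by auto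
  then have "0 < r" "r \<le> theta \<Omega> V i"
    using admissible_bdd[OF assms] by (auto simp: theta_eq_Sup admissible_def intro: cSup_upper)
  then show ?thesis by linarith
qed

lemma theta_Suc_le:
  assumes "i \<in> {1..M}" "Suc i \<in> {1..M}"
  shows "theta \<Omega> V (Suc i) \<le> theta \<Omega> V i"
  unfolding theta_eq_Sup using admissible_nonempty[of "Suc i"] admissible_bdd[OF assms(1)] assms
  by (intro cSup_subset_mono) (auto simp: admissible_def)

lemma exp_moment_theta_le_1:
  assumes "i \<in> {1..M}" "j \<in> {1..i}"
  shows "exp_moment \<Omega> (V j) (theta \<Omega> V i) \<le> 1"
proof -
  define t where "t = theta \<Omega> V i"
  have t: "0 < t" using theta_pos assms by (simp add: t_def)
  have j [measurable]: "V j \<in> borel_measurable \<Omega>" using assms meas by auto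
  have below: "exp_moment \<Omega> (V j) r \<le> 1" if r: "0 < r" "r < t" for r
  proof -
    obtain q where "q \<in> admissible i" "r < q"
      using r(2) admissible_nonempty[of i] assms(1)
      unfolding t_def theta_eq_Sup by (auto elim: less_cSupE)
    then have "exp_moment \<Omega> (V j) q \<le> 1"
      using assms(2) by (simp add: admissible_def)
    then show ?thesis
      using exp_moment_le_1_downward[OF prob j] r(1) \<open>r < q\<close> by simp
  qed
  define r where "r k = t * (1 - inverse (real (Suc (Suc k))))" for k
  have "exp_moment \<Omega> (V j) (r k) \<le> 1" for k
  proof -
    have "0 < inverse (real (Suc (Suc k)))" "inverse (real (Suc (Suc k))) < 1"
      by (auto simp: inverse_less_1_iff)
    then show ?thesis
      using t by (intro below) (simp_all add: r_def mult_less_cancel_left2)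
  qed
  moreover have "r \<longlonglongrightarrow> t"
  proof -
    have "(\<lambda>k. t * (1 - inverse (real (Suc (Suc k))))) \<longlonglongrightarrow> t * (1 - 0)"
      by (intro tendsto_intros LIMSEQ_Suc[OF LIMSEQ_inverse_real_of_nat])
    then show ?thesis by (simp add: r_def[abs_def])
  qed
  ultimately show ?thesis
    unfolding t_def[symmetric] by (rule exp_moment_le_1_limit[OF j, rotated])
qed

end

section \<open>One coordinate under the tilted measure\<close>

text \<open>On the negative half line \<open>exp (t * x)\<close> beats every power of \<open>x\<close>; on the positive one the power
  is \<open>1\<close>.\<close>
lemma integrable_exp_mult_neg_part_power:
  fixes X :: "'a \<Rightarrow> real"
  assumes "prob_space \<Omega>" and [measurable]: "X \<in> borel_measurable \<Omega>"
    and "0 < t" "exp_moment \<Omega> X t \<le> 1"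
  shows "integrable \<Omega> (\<lambda>\<omega>. exp (t * X \<omega>) * (1 + max (- X \<omega>) 0) ^ k)"
proof -
  interpret prob_space \<Omega> by fact
  obtain C where C: "0 < C" "\<And>u. 0 \<le> u \<Longrightarrow> (1 + u) ^ k \<le> C * exp (t * u)"
    using power_le_const_mult_exp[OF assms(3)] by metis
  have "exp (t * x) * (1 + max (- x) 0) ^ k \<le> C * (1 + exp (t * x))" for x
  proof -
    have "exp (t * x) * (1 + max (- x) 0) ^ k \<le> exp (t * x) * (C * exp (t * max (- x) 0))"
      using C(2)[of "max (- x) 0"] by (intro mult_left_mono) auto
    also have "\<dots> = C * exp (t * max x 0)"
      by (auto simp: max_def exp_minus)
    also have "\<dots> \<le> C * (1 + exp (t * x))"
      using C(1) by (intro mult_left_mono) (auto simp: max_def)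
    finally show ?thesis .
  qed
  then have bound: "norm (exp (t * X \<omega>) * (1 + max (- X \<omega>) 0) ^ k) \<le> norm (C * (1 + exp (t * X \<omega>)))" for \<omega>
    using C(1) by (simp add: abs_mult)
  have "integrable \<Omega> (\<lambda>\<omega>. C * (1 + exp (t * X \<omega>)))"
    using exp_moment_le_1_integrable(1)[OF assms(2,4)] by simp
  then show ?thesis
    by (rule Bochner_Integration.integrable_bound) (use bound in auto)
qed

text \<open>Below \<open>x\<close> the variable \<open>exp (t * X) * X\<close> is controlled by the exponential moment. Above \<open>x\<close> it
  is controlled by the conditional first moment of the excess at a single threshold \<open>x\<close>, because the
  weight there only grows when \<open>t\<close> is replaced by \<open>z\<close>.\<close>
lemma integrable_exp_mult_of_cond_excess:
  fixes X :: "'a \<Rightarrow> real"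
  assumes "prob_space \<Omega>" and [measurable]: "X \<in> borel_measurable \<Omega>"
    and t: "0 < t" "exp_moment \<Omega> X t \<le> 1" and "t \<le> z"
    and excess: "measure \<Omega> {\<omega>\<in>space \<Omega>. X \<omega> > x} > 0 \<Longrightarrow> cond_excess_moment \<Omega> X z x 1 \<le> ennreal K"
  shows "integrable \<Omega> (\<lambda>\<omega>. exp (t * X \<omega>) * X \<omega>)"
proof -
  interpret prob_space \<Omega> by fact
  define E where "E = {\<omega>\<in>space \<Omega>. X \<omega> > x}"
  have E [measurable]: "E \<in> sets \<Omega>" unfolding E_def by measurable
  define g where "g \<omega> = indicator E \<omega> * ((X \<omega> - x) * exp (z * (X \<omega> - x)))" for \<omega>
  have [measurable]: "g \<in> borel_measurable \<Omega>" unfolding g_def by measurable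
  have g_nonneg: "0 \<le> g \<omega>" for \<omega> by (auto simp: g_def E_def split: split_indicator)
  have "(\<integral>\<^sup>+\<omega>. ennreal (g \<omega>) \<partial>\<Omega>) < \<infinity>"
  proof (cases "measure \<Omega> E > 0")
    case True
    have "cond_excess_moment \<Omega> X z x 1
        = (\<integral>\<^sup>+\<omega>. ennreal ((X \<omega> - x) ^ 1 * exp (z * (X \<omega> - x))) * indicator E \<omega> \<partial>\<Omega>) / emeasure \<Omega> E"
      unfolding cond_excess_moment_def E_def[symmetric]
      by (rule nn_integral_uniform_measure) auto
    also have "(\<integral>\<^sup>+\<omega>. ennreal ((X \<omega> - x) ^ 1 * exp (z * (X \<omega> - x))) * indicator E \<omega> \<partial>\<Omega>)
        = (\<integral>\<^sup>+\<omega>. ennreal (g \<omega>) \<partial>\<Omega>)"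
      unfolding g_def by (intro nn_integral_cong) (auto split: split_indicator)
    finally have "(\<integral>\<^sup>+\<omega>. ennreal (g \<omega>) \<partial>\<Omega>) / emeasure \<Omega> E < \<infinity>"
      using excess True by (auto simp: E_def intro: le_less_trans)
    then show ?thesis
      using emeasure_finite[of E] by (auto simp: ennreal_divide_eq_top_iff less_top[symmetric])
  next
    case False
    then have "prob E = 0"
      using measure_nonneg[of \<Omega> E] by linarith
    then have "AE \<omega> in \<Omega>. \<omega> \<notin> E"
      by (simp add: prob_eq_0)
    then have "AE \<omega> in \<Omega>. ennreal (g \<omega>) = 0"
      by eventually_elim (auto simp: g_def)
    then have "(\<integral>\<^sup>+\<omega>. ennreal (g \<omega>) \<partial>\<Omega>) = 0" by (subst nn_integral_0_iff_AE) auto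
    then show ?thesis by simp
  qed
  then have int_g: "integrable \<Omega> g" using g_nonneg by (intro integrableI_nonneg) auto
  show ?thesis
  proof (rule Bochner_Integration.integrable_bound)
    show "integrable \<Omega> (\<lambda>\<omega>. exp (t * X \<omega>) * (1 + max (- X \<omega>) 0) ^ 1
        + \<bar>x\<bar> * exp (t * X \<omega>) + exp (t * x) * g \<omega>)"
      using int_g integrable_exp_mult_neg_part_power[OF assms(1,2) t, of 1]
        exp_moment_le_1_integrable(1)[OF assms(2) t(2)]
      by (intro Bochner_Integration.integrable_add integrable_mult_right) auto
    have "norm (exp (t * X \<omega>) * X \<omega>) \<le> exp (t * X \<omega>) * (1 + max (- X \<omega>) 0) ^ 1
        + \<bar>x\<bar> * exp (t * X \<omega>) + exp (t * x) * g \<omega>" if "\<omega> \<in> space \<Omega>" for \<omega>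
    proof -
      have "exp (t * X \<omega>) * max (X \<omega> - x) 0 \<le> exp (t * x) * g \<omega>"
      proof (cases "X \<omega> > x")
        case True
        have "exp (t * X \<omega>) * max (X \<omega> - x) 0 = exp (t * x) * ((X \<omega> - x) * exp (t * (X \<omega> - x)))"
          using True by (simp add: algebra_simps flip: exp_add)
        also have "\<dots> \<le> exp (t * x) * ((X \<omega> - x) * exp (z * (X \<omega> - x)))"
          using True \<open>t \<le> z\<close> by (intro mult_left_mono) (auto intro!: mult_right_mono)
        also have "\<dots> = exp (t * x) * g \<omega>"
          using True that by (simp add: g_def E_def)
        finally show ?thesis .
      qed (use g_nonneg[of \<omega>] in \<open>auto simp: max_def\<close>)
      moreover have "exp (t * X \<omega>) * \<bar>X \<omega>\<bar>
          \<le> exp (t * X \<omega>) * ((1 + max (- X \<omega>) 0) + \<bar>x\<bar> + max (X \<omega> - x) 0)"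
        by (intro mult_left_mono) auto
      ultimately show ?thesis by (simp add: abs_mult algebra_simps)
    qed
    then show "AE \<omega> in \<Omega>. norm (exp (t * X \<omega>) * X \<omega>) \<le> norm (exp (t * X \<omega>) * (1 + max (- X \<omega>) 0) ^ 1
        + \<bar>x\<bar> * exp (t * X \<omega>) + exp (t * x) * g \<omega>)"
      unfolding real_norm_def by (intro AE_I2 order_trans[OF _ abs_ge_self])
  qed auto
qed

definition tilt :: "'a measure \<Rightarrow> ('a \<Rightarrow> real) \<Rightarrow> real \<Rightarrow> 'a measure" where
  "tilt \<Omega> X t = density \<Omega> (\<lambda>\<omega>. ennreal (exp (t * X \<omega>)))"

lemma sets_tilt [simp, measurable_cong]: "sets (tilt \<Omega> X t) = sets \<Omega>"
  and space_tilt [simp]: "space (tilt \<Omega> X t) = space \<Omega>"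
  by (simp_all add: tilt_def)

lemma emeasure_space_tilt:
  assumes [measurable]: "X \<in> borel_measurable \<Omega>"
  shows "emeasure (tilt \<Omega> X t) (space \<Omega>) = exp_moment \<Omega> X t"
  unfolding tilt_def exp_moment_def
  by (subst emeasure_density) (auto intro!: nn_integral_cong)

lemma integrable_tilt_iff:
  fixes f :: "'a \<Rightarrow> real"
  assumes [measurable]: "X \<in> borel_measurable \<Omega>" "f \<in> borel_measurable \<Omega>"
  shows "integrable (tilt \<Omega> X t) f \<longleftrightarrow> integrable \<Omega> (\<lambda>\<omega>. exp (t * X \<omega>) * f \<omega>)"
  unfolding tilt_def by (subst integrable_density) auto

text \<open>The slack available to one coordinate. The degree is raised by one exactly at a critical
  exponent, and the gap is of order \<open>u ^ e\<close> in both cases.\<close>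
lemma tilted_gap:
  fixes X :: "'a \<Rightarrow> real"
  assumes "prob_space \<Omega>" and [measurable]: "X \<in> borel_measurable \<Omega>"
    and pos: "0 < measure \<Omega> {\<omega>\<in>space \<Omega>. X \<omega> > 0}"
    and t: "0 < t" "exp_moment \<Omega> X t \<le> 1"
    and crit: "exp_moment \<Omega> X t = 1 \<Longrightarrow> integrable \<Omega> (\<lambda>\<omega>. exp (t * X \<omega>) * X \<omega>)"
    and n: "n = e + (if exp_moment \<Omega> X t = 1 then 1 else 0)"
  shows "\<exists>s\<ge>1. \<exists>\<delta>>0. \<forall>u\<ge>s. (\<integral>\<omega>. max (u - X \<omega>) 0 ^ n \<partial>tilt \<Omega> X t) \<le> u ^ n - \<delta> * u ^ e"
proof -
  have X_tilt: "X \<in> borel_measurable (tilt \<Omega> X t)" by simp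
  have mom: "integrable (tilt \<Omega> X t) (\<lambda>\<omega>. (1 + max (- X \<omega>) 0) ^ k)" for k
    using integrable_exp_mult_neg_part_power[OF assms(1,2) t] by (subst integrable_tilt_iff) auto
  show ?thesis
  proof (cases "exp_moment \<Omega> X t = 1")
    case True
    have "prob_space (tilt \<Omega> X t)"
      using True emeasure_space_tilt[of X \<Omega> t] by (intro prob_spaceI) simp
    moreover have "integrable (tilt \<Omega> X t) X"
      using crit[OF True] by (subst integrable_tilt_iff) auto
    moreover have "0 < integral\<^sup>L (tilt \<Omega> X t) X"
      using tilted_drift_pos[OF assms(1,2) pos t(1) True crit[OF True]]
      unfolding tilt_def by (subst integral_density) auto
    ultimately show ?thesis
      using gap_critical[OF _ X_tilt mom, of e] n True by simp
  next
    case False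
    have lt: "emeasure (tilt \<Omega> X t) (space (tilt \<Omega> X t)) < 1"
      using False t(2) emeasure_space_tilt[of X \<Omega> t] by (simp add: less_le)
    then have "finite_measure (tilt \<Omega> X t)"
      by (intro finite_measureI) auto
    moreover from this have "measure (tilt \<Omega> X t) (space (tilt \<Omega> X t)) < 1"
      using lt by (simp add: finite_measure.emeasure_eq_measure ennreal_less_one_iff del: space_tilt)
    ultimately show ?thesis
      using gap_subcritical[OF _ X_tilt mom, of e] n False by simp
  qed
qed

text \<open>The function \<open>g\<close> stands for the term of the preceding coordinate, and the value \<open>1\<close> for an exit
  from the domain. After multiplication by \<open>exp (t * v)\<close>, the mean of the first under the tilted
  measure is of order \<open>(v + a + s) ^ e\<close> and that of the second is bounded by Chernoff's inequality. The gap of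
  \<open>tilted_gap\<close>, multiplied by a large \<open>c\<close>, absorbs both.\<close>
lemma one_step_drift:
  fixes X :: "'a \<Rightarrow> real" and g :: "real \<Rightarrow> real"
  assumes "prob_space \<Omega>" and [measurable]: "X \<in> borel_measurable \<Omega>"
    and pos: "0 < measure \<Omega> {\<omega>\<in>space \<Omega>. X \<omega> > 0}"
    and t: "0 < t" "exp_moment \<Omega> X t \<le> 1"
    and crit: "exp_moment \<Omega> X t = 1 \<Longrightarrow> integrable \<Omega> (\<lambda>\<omega>. exp (t * X \<omega>) * X \<omega>)"
    and n: "n = e + (if exp_moment \<Omega> X t = 1 then 1 else 0)"
    and A: "0 \<le> A" and g: "\<And>x. - a \<le> x \<Longrightarrow> g x \<le> A * (x + a + 1) ^ e * exp (- t * x)"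
  shows "\<exists>c\<ge>1. \<exists>s\<ge>1. \<forall>v\<ge>- a.
    (\<integral>\<^sup>+\<omega>. ennreal (if - a \<le> v - X \<omega>
        then c * (v - X \<omega> + a + s) ^ n * exp (- t * (v - X \<omega>)) + g (v - X \<omega>) else 1) \<partial>\<Omega>)
      \<le> ennreal (c * (v + a + s) ^ n * exp (- t * v))"
proof -
  interpret prob_space \<Omega> by fact
  define Q where "Q = tilt \<Omega> X t"
  have [measurable]: "X \<in> borel_measurable Q" by (simp add: Q_def)
  have mom: "integrable Q (\<lambda>\<omega>. (1 + max (- X \<omega>) 0) ^ k)" for k
    unfolding Q_def using integrable_exp_mult_neg_part_power[OF assms(1,2) t]
    by (subst integrable_tilt_iff) auto
  have mass: "emeasure Q (space Q) \<le> 1"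
    using t(2) emeasure_space_tilt[of X \<Omega> t] by (simp add: Q_def)
  interpret Q: finite_measure Q
    by (rule finite_measureI) (use mass in \<open>auto simp: top_unique\<close>)
  have mass': "measure Q (space Q) \<le> 1"
    using mass by (simp add: Q.emeasure_eq_measure)
  obtain s \<delta> where s: "1 \<le> s" "0 < \<delta>"
    and gap: "\<And>u. s \<le> u \<Longrightarrow> (\<integral>\<omega>. max (u - X \<omega>) 0 ^ n \<partial>Q) \<le> u ^ n - \<delta> * u ^ e"
    using tilted_gap[OF assms(1,2) pos t crit n] unfolding Q_def by metis
  note int = integrable_shortfall_power[OF \<open>X \<in> borel_measurable Q\<close> mom]
  define B where "B = (\<integral>\<omega>. (1 + max (- X \<omega>) 0) ^ e \<partial>Q)"
  have B: "(\<integral>\<omega>. max (u - X \<omega>) 0 ^ e \<partial>Q) \<le> B * u ^ e" if "1 \<le> u" for u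
  proof -
    have "(\<integral>\<omega>. max (u - X \<omega>) 0 ^ e \<partial>Q) \<le> (\<integral>\<omega>. u ^ e * (1 + max (- X \<omega>) 0) ^ e \<partial>Q)"
      using that shortfall_power_le[of 1 u] mom[of e] by (intro integral_mono int) auto
    then show ?thesis by (simp add: B_def mult.commute)
  qed
  \<comment> \<open>\<open>A * B\<close> pays for \<open>g\<close>, and \<open>exp (- t * a)\<close> for the exit.\<close>
  define c where "c = max 1 ((A * B + exp (- t * a)) / \<delta>)"
  have c: "1 \<le> c" "A * B + exp (- t * a) \<le> c * \<delta>"
  proof -
    have "(A * B + exp (- t * a)) / \<delta> \<le> c" by (simp add: c_def)
    then show "A * B + exp (- t * a) \<le> c * \<delta>" using s by (simp add: field_simps)
  qed (simp add: c_def)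
  have "(\<integral>\<^sup>+\<omega>. ennreal (if - a \<le> v - X \<omega>
        then c * (v - X \<omega> + a + s) ^ n * exp (- t * (v - X \<omega>)) + g (v - X \<omega>) else 1) \<partial>\<Omega>)
      \<le> ennreal (c * (v + a + s) ^ n * exp (- t * v))" (is "?L \<le> _") if v: "- a \<le> v" for v
  proof -
    define u where "u = v + a + s"
    have u: "s \<le> u" "1 \<le> u" using v s by (auto simp: u_def)
    define R where "R \<omega> = exp (- t * v) *
      (c * max (u - X \<omega>) 0 ^ n + A * max (u - X \<omega>) 0 ^ e + exp (- t * a))" for \<omega>
    have R_nonneg: "0 \<le> R \<omega>" for \<omega> using A c by (simp add: R_def)
    have [measurable]: "R \<in> borel_measurable \<Omega>" unfolding R_def by measurable
    have int_R: "integrable Q R" unfolding R_def using int[OF u(2)] by auto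
    have pw: "(if - a \<le> v - X \<omega>
        then c * (v - X \<omega> + a + s) ^ n * exp (- t * (v - X \<omega>)) + g (v - X \<omega>) else 1)
        \<le> exp (t * X \<omega>) * R \<omega>" for \<omega>
    proof (cases "- a \<le> v - X \<omega>")
      case True
      have m: "max (u - X \<omega>) 0 = v - X \<omega> + a + s" using True s by (simp add: u_def)
      have e: "exp (- t * (v - X \<omega>)) = exp (- t * v) * exp (t * X \<omega>)"
        by (simp add: algebra_simps flip: exp_add)
      have "g (v - X \<omega>) \<le> A * (v - X \<omega> + a + 1) ^ e * exp (- t * (v - X \<omega>))"
        using g True by blast
      also have "\<dots> \<le> A * (v - X \<omega> + a + s) ^ e * exp (- t * (v - X \<omega>))"
        using A s True by (intro mult_right_mono mult_left_mono power_mono) auto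
      also have "\<dots> \<le> (A * (v - X \<omega> + a + s) ^ e + exp (- t * a)) * exp (- t * (v - X \<omega>))"
        by (intro mult_right_mono) auto
      finally show ?thesis
        using True unfolding R_def m e by (simp add: algebra_simps)
    next
      case False
      have "1 \<le> exp (t * (X \<omega> - v - a))" using False t by simp
      also have "\<dots> = exp (t * X \<omega>) * (exp (- t * v) * exp (- t * a))"
        by (simp add: algebra_simps flip: exp_add)
      also have "\<dots> \<le> exp (t * X \<omega>) * R \<omega>"
        unfolding R_def using A c by (intro mult_left_mono) auto
      finally show ?thesis using False by simp
    qed
    have "?L \<le> (\<integral>\<^sup>+\<omega>. ennreal (exp (t * X \<omega>)) * ennreal (R \<omega>) \<partial>\<Omega>)"
      using pw R_nonneg by (intro nn_integral_mono) (simp add: ennreal_mult[symmetric] ennreal_leI)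
    also have "\<dots> = (\<integral>\<^sup>+\<omega>. ennreal (R \<omega>) \<partial>Q)"
      unfolding Q_def tilt_def by (subst nn_integral_density) auto
    also have "\<dots> = ennreal (integral\<^sup>L Q R)"
      using R_nonneg by (intro nn_integral_eq_integral int_R) auto
    also have "\<dots> \<le> ennreal (c * u ^ n * exp (- t * v))"
    proof (intro ennreal_leI)
      have "integral\<^sup>L Q R = exp (- t * v) * (c * (\<integral>\<omega>. max (u - X \<omega>) 0 ^ n \<partial>Q)
          + A * (\<integral>\<omega>. max (u - X \<omega>) 0 ^ e \<partial>Q) + exp (- t * a) * measure Q (space Q))"
        unfolding R_def using int[OF u(2)] by (simp add: mult.commute)
      also have "\<dots> \<le> exp (- t * v) * (c * (u ^ n - \<delta> * u ^ e)
          + A * (B * u ^ e) + exp (- t * a) * u ^ e)"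
      proof -
        have "measure Q (space Q) \<le> u ^ e"
          using mass' one_le_power[OF u(2), of e] by linarith
        then show ?thesis
          using gap[OF u(1)] B[OF u(2)] A c by (intro mult_left_mono add_mono) auto
      qed
      also have "\<dots> = exp (- t * v) * (c * u ^ n - (c * \<delta> - (A * B + exp (- t * a))) * u ^ e)"
        by (simp add: algebra_simps)
      also have "\<dots> \<le> exp (- t * v) * (c * u ^ n)"
        using c(2) u by (intro mult_left_mono) auto
      finally show "integral\<^sup>L Q R \<le> c * u ^ n * exp (- t * v)" by (simp add: mult_ac)
    qed
    finally show ?thesis by (simp add: u_def)
  qed
  then show ?thesis using c(1) s(1) by blast
qed

text \<open>If the exponent drops strictly, then the exponential factor gained absorbs the whole polynomial,
  and any degree \<open>e\<close> will do. If it stays the same, then the degree is carried along.\<close>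
lemma poly_exp_dominated:
  fixes a :: real
  assumes "1 \<le> s" "0 \<le> c" and tt: "t < t' \<or> (t = t' \<and> d = e)"
  shows "\<exists>A\<ge>0. \<forall>x\<ge>- a. c * (x + a + s) ^ d * exp (- t' * x) \<le> A * (x + a + 1) ^ e * exp (- t * x)"
proof -
  have scale: "(x + a + s) ^ d \<le> s ^ d * (x + a + 1) ^ d" if "- a \<le> x" for x
  proof -
    have "1 * (x + a) \<le> s * (x + a)" using that assms(1) by (intro mult_right_mono) auto
    then have "(x + a + s) ^ d \<le> (s * (x + a + 1)) ^ d"
      using that assms by (intro power_mono) (auto simp: algebra_simps)
    then show ?thesis by (simp add: power_mult_distrib)
  qed
  show ?thesis
  proof (cases "t = t' \<and> d = e")
    case True
    then show ?thesis
      using scale assms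
      by (intro exI[of _ "c * s ^ d"]) (auto simp: mult.assoc intro!: mult_left_mono mult_right_mono)
  next
    case False
    then have "0 < t' - t" using tt by auto
    from power_le_const_mult_exp[OF this, of d]
    obtain C where C: "0 < C" "\<And>u. 0 \<le> u \<Longrightarrow> (1 + u) ^ d \<le> C * exp ((t' - t) * u)" by metis
    define A where "A = c * (s ^ d * (C * exp ((t' - t) * a)))"
    have "c * (x + a + s) ^ d * exp (- t' * x) \<le> A * (x + a + 1) ^ e * exp (- t * x)"
      if x: "- a \<le> x" for x
    proof -
      have "(x + a + s) ^ d \<le> s ^ d * (C * exp ((t' - t) * (x + a)))"
        using C(2)[of "x + a"] x assms(1)
        by (intro order_trans[OF scale[OF x]] mult_left_mono) (auto simp: add.commute)
      then have "c * (x + a + s) ^ d * exp (- t' * x)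
          \<le> c * (s ^ d * (C * exp ((t' - t) * (x + a)))) * exp (- t' * x)"
        using assms by (intro mult_right_mono mult_left_mono) auto
      also have "\<dots> = A * exp (- t * x)"
        by (simp add: A_def algebra_simps flip: exp_add)
      also have "\<dots> \<le> A * exp (- t * x) * (x + a + 1) ^ e"
        using mult_left_mono[of 1 "(x + a + 1) ^ e" "A * exp (- t * x)"] one_le_power[of "x + a + 1" e]
          C(1) assms x by (simp add: A_def)
      finally show ?thesis by (simp add: mult_ac)
    qed
    moreover have "0 \<le> A" using C assms by (simp add: A_def)
    ultimately show ?thesis by blast
  qed
qed

section \<open>Combining the coordinates\<close>

text \<open>The random variable \<open>Z\<close> is the integrand on the right and \<open>Y\<close> a pointwise lower bound that is
  a sum of functions of single coordinates. If the step stays in the domain, then \<open>Y \<le> Z\<close> because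
  \<open>f i (min x y) \<le> f i x + f i y\<close>. Otherwise \<open>Z = 0\<close> and some summand of \<open>1 - Y\<close> is at least one.
  The upper bound \<open>Z \<le> 1\<close> then gives integrability.\<close>
lemma drift_inequality:
  fixes f :: "nat \<Rightarrow> real \<Rightarrow> real"
  assumes "prob_space \<Omega>" and M: "1 \<le> M"
    and V [measurable]: "\<And>i. i \<in> {1..M} \<Longrightarrow> V i \<in> borel_measurable \<Omega>"
    and f [measurable]: "\<And>i. f i \<in> borel_measurable borel"
    and P: "\<And>i w. i \<in> {1..M} \<Longrightarrow> mv_eval (P i) w * exp (- th i * w i) = f i (w i)"
    and f1: "\<And>x. 0 \<le> f 1 x" "\<And>x. x < 0 \<Longrightarrow> 1 \<le> f 1 x"
    and f_nonneg: "\<And>i x. i \<in> {2..M} \<Longrightarrow> - a \<le> x \<Longrightarrow> 0 \<le> f i x"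
    and step1: "\<And>x. (\<integral>\<^sup>+\<omega>. ennreal (f 1 (x - V 1 \<omega>)) \<partial>\<Omega>) \<le> ennreal (f 1 x)"
    and step: "\<And>i x. i \<in> {2..M} \<Longrightarrow> - a \<le> x \<Longrightarrow>
      (\<integral>\<^sup>+\<omega>. ennreal (if - a \<le> x - V i \<omega> then f i (x - V i \<omega>) + f (i - 1) (x - V i \<omega>) else 1) \<partial>\<Omega>)
        \<le> ennreal (f i x)"
    and v: "v \<in> dom_D M a"
  shows "gamma_fn M a th P v \<le>
    (\<integral>\<omega>. indicator {\<omega>. v 1 \<ge> V 1 \<omega>} \<omega> * gamma_fn M a th P (shift_min M v (\<lambda>i. V i \<omega>)) \<partial>\<Omega>)"
proof -
  interpret prob_space \<Omega> by fact
  have gamma: "gamma_fn M a th P w =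
      (if - max a 0 \<le> w 1 \<and> (\<forall>i\<in>{2..M}. - a \<le> w i) then 1 - (\<Sum>i=1..M. f i (w i)) else 0)" for w
    unfolding gamma_fn_def dom_D_def using P[of _ w] by (auto simp: indicator_def)
  define w where "w \<omega> = shift_min M v (\<lambda>i. V i \<omega>)" for \<omega>
  define A where "A i \<omega> = v i - V i \<omega>" for i \<omega>
  have w: "w \<omega> i = (if i < M then min (A i \<omega>) (A (Suc i) \<omega>) else A i \<omega>)" for \<omega> i
    by (simp add: w_def A_def shift_min_def)
  have v1: "- max a 0 \<le> v 1" and v2: "- a \<le> v i" if "i \<in> {2..M}" for i
    using v that by (auto simp: dom_D_def)
  have A_meas [measurable]: "A i \<in> borel_measurable \<Omega>" if "i \<in> {1..M}" for i
    unfolding A_def using that by measurable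
  have w_meas [measurable]: "(\<lambda>\<omega>. w \<omega> i) \<in> borel_measurable \<Omega>" if "i \<in> {1..M}" for i
    using that unfolding w by (cases "i < M") auto
  define h where "h i x = (if i = 1 then f 1 x else if - a \<le> x then f i x + f (i - 1) x else 1)" for i x
  have f_pred_nonneg: "0 \<le> f (i - 1) x" if "i \<in> {2..M}" "- a \<le> x" for i x
  proof (cases "i = 2")
    case False
    then have "i - 1 \<in> {2..M}" using that(1) by auto
    then show ?thesis using f_nonneg that(2) by blast
  qed (use f1(1) in simp)
  have h_nonneg: "0 \<le> h i x" if "i \<in> {1..M}" for i x
    using that f1(1) f_nonneg[of i x] f_pred_nonneg[of i x] by (auto simp: h_def)
  have [measurable]: "h i \<in> borel_measurable borel" for i
    unfolding h_def by measurable
  have f_v: "0 \<le> f i (v i)" if "i \<in> {1..M}" for i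
    using that f1(1) f_nonneg[of i "v i"] v2[of i] by (cases "i = 1") auto
  have h_int: "(\<integral>\<^sup>+\<omega>. ennreal (h i (A i \<omega>)) \<partial>\<Omega>) \<le> ennreal (f i (v i))" if "i \<in> {1..M}" for i
    using that step1[of "v 1"] step[of i "v i"] v2[of i] by (cases "i = 1") (auto simp: h_def A_def)
  have int_h: "integrable \<Omega> (\<lambda>\<omega>. h i (A i \<omega>))" if i: "i \<in> {1..M}" for i
    using i h_nonneg[OF i] le_less_trans[OF h_int[OF i] ennreal_less_top]
    by (intro integrableI_nonneg) auto
  have h_le: "(\<integral>\<omega>. h i (A i \<omega>) \<partial>\<Omega>) \<le> f i (v i)" if i: "i \<in> {1..M}" for i
  proof -
    have "ennreal (\<integral>\<omega>. h i (A i \<omega>) \<partial>\<Omega>) \<le> ennreal (f i (v i))"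
      using h_int[OF i] h_nonneg[OF i] by (subst nn_integral_eq_integral[OF int_h[OF i], symmetric]) auto
    then show ?thesis using f_v[OF i] by (simp add: ennreal_le_iff)
  qed
  define Y where "Y \<omega> = 1 - (\<Sum>i=1..M. h i (A i \<omega>))" for \<omega>
  define Z where "Z \<omega> = (if 0 \<le> A 1 \<omega> \<and> - max a 0 \<le> w \<omega> 1 \<and> (\<forall>i\<in>{2..M}. - a \<le> w \<omega> i)
      then 1 - (\<Sum>i=1..M. f i (w \<omega> i)) else 0)" for \<omega>
  have int_Y: "integrable \<Omega> Y"
    unfolding Y_def using int_h by (intro Bochner_Integration.integrable_diff Bochner_Integration.integrable_sum) auto
  have one: "1 \<in> {1..M}" using M by auto
  have "Z \<in> borel_measurable \<Omega>"
  proof -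
    have [measurable]: "Measurable.pred \<Omega> (\<lambda>\<omega>. - a \<le> w \<omega> i)" if "i \<in> {2..M}" for i
      using w_meas[of i] that by simp
    have "Measurable.pred \<Omega> (\<lambda>\<omega>. \<forall>i\<in>{2..M}. - a \<le> w \<omega> i)"
      by (rule pred_intros_finite) simp_all
    moreover have "(\<lambda>\<omega>. \<Sum>i=1..M. f i (w \<omega> i)) \<in> borel_measurable \<Omega>"
      using measurable_compose[OF w_meas f] by (intro borel_measurable_sum)
    ultimately show ?thesis
      using A_meas[OF one] w_meas[OF one] unfolding Z_def by measurable
  qed
  note [measurable] = this
  have Y_le_Z: "Y \<omega> \<le> Z \<omega>" for \<omega>
  proof (cases "0 \<le> A 1 \<omega> \<and> (\<forall>i\<in>{2..M}. - a \<le> A i \<omega>)")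
    case True
    have A2: "- a \<le> A i \<omega>" if "i \<in> {2..M}" for i using True that by blast
    have "- a \<le> A (Suc 1) \<omega>" if "1 < M"
      using A2[of "Suc 1"] that by simp
    moreover have "- max a 0 \<le> x" if "0 \<le> x \<or> - a \<le> x" for x
      using that by auto
    ultimately have "- max a 0 \<le> w \<omega> 1" using True by (simp add: w)
    moreover have "- a \<le> w \<omega> i" if "i \<in> {2..M}" for i
      using A2[OF that] A2[of "Suc i"] that by (auto simp: w)
    ultimately have Z: "Z \<omega> = 1 - (\<Sum>i=1..M. f i (w \<omega> i))"
      using True by (auto simp: Z_def)
    have "f i (w \<omega> i) \<le> f i (A i \<omega>) + (if i < M then f i (A (Suc i) \<omega>) else 0)" if i: "i \<in> {1..M}" for i
    proof -
      have "0 \<le> f i (A i \<omega>)"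
        using i f1(1) f_nonneg[of i] A2[of i] by (cases "i = 1") auto
      moreover have "0 \<le> f i (A (Suc i) \<omega>)" if "i < M"
        using that i f_pred_nonneg[of "Suc i" "A (Suc i) \<omega>"] A2[of "Suc i"] by auto
      ultimately show ?thesis by (auto simp: w min_def)
    qed
    then have "(\<Sum>i=1..M. f i (w \<omega> i)) \<le>
        (\<Sum>i=1..M. f i (A i \<omega>) + (if i < M then f i (A (Suc i) \<omega>) else 0))"
      by (rule sum_mono)
    also have "\<dots> = (\<Sum>i=1..M. f i (A i \<omega>)) + (\<Sum>i=1..M. if i < M then f i (A (Suc i) \<omega>) else 0)"
      by (rule sum.distrib)
    also have "(\<Sum>i=1..M. if i < M then f i (A (Suc i) \<omega>) else 0)
        = (\<Sum>i=1..M. if i = 1 then 0 else f (i - 1) (A i \<omega>))"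
    proof -
      have "(\<Sum>i=1..M. if i < M then f i (A (Suc i) \<omega>) else 0) = (\<Sum>i\<in>{1..<M}. f i (A (Suc i) \<omega>))"
        by (rule sum.mono_neutral_cong_right) auto
      also have "\<dots> = (\<Sum>i\<in>{2..M}. f (i - 1) (A i \<omega>))"
        by (rule sum.reindex_bij_witness[of _ "\<lambda>i. i - 1" Suc]) auto
      also have "\<dots> = (\<Sum>i=1..M. if i = 1 then 0 else f (i - 1) (A i \<omega>))"
        by (rule sum.mono_neutral_cong_left) auto
      finally show ?thesis .
    qed
    also have "(\<Sum>i=1..M. f i (A i \<omega>)) + (\<Sum>i=1..M. if i = 1 then 0 else f (i - 1) (A i \<omega>))
        = (\<Sum>i=1..M. h i (A i \<omega>))"
      unfolding sum.distrib[symmetric] using A2 by (intro sum.cong) (auto simp: h_def)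
    finally show ?thesis by (simp add: Z Y_def)
  next
    case False
    have "\<exists>i\<in>{1..M}. 1 \<le> h i (A i \<omega>)"
    proof (cases "0 \<le> A 1 \<omega>")
      case True
      with False obtain i where "i \<in> {2..M}" "\<not> - a \<le> A i \<omega>" by blast
      then show ?thesis by (intro bexI[of _ i]) (auto simp: h_def)
    next
      case False
      then show ?thesis using f1(2)[of "A 1 \<omega>"] one by (intro bexI[of _ 1]) (auto simp: h_def)
    qed
    then obtain i where i: "i \<in> {1..M}" "1 \<le> h i (A i \<omega>)" by blast
    have "h i (A i \<omega>) \<le> (\<Sum>i=1..M. h i (A i \<omega>))"
      using i(1) h_nonneg by (intro member_le_sum) auto
    then have "Y \<omega> \<le> 0" using i(2) by (simp add: Y_def)
    moreover have "Z \<omega> = 0"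
    proof -
      have "w \<omega> i \<le> A i \<omega>" for i by (simp add: w)
      then have "\<not> (0 \<le> A 1 \<omega> \<and> (\<forall>i\<in>{2..M}. - a \<le> w \<omega> i))"
        using False by (meson order_trans)
      then show ?thesis by (auto simp: Z_def)
    qed
    ultimately show ?thesis by simp
  qed
  have Z_le: "Z \<omega> \<le> 1" for \<omega>
  proof -
    have "0 \<le> (\<Sum>i=1..M. f i (w \<omega> i))" if "\<forall>i\<in>{2..M}. - a \<le> w \<omega> i"
    proof (rule sum_nonneg)
      fix i assume "i \<in> {1..M}"
      then show "0 \<le> f i (w \<omega> i)"
        using that f1(1) f_nonneg[of i "w \<omega> i"] by (cases "i = 1") auto
    qed
    then show ?thesis by (auto simp: Z_def)
  qed
  have int_Z: "integrable \<Omega> Z"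
  proof (rule Bochner_Integration.integrable_bound)
    show "integrable \<Omega> (\<lambda>\<omega>. 1 + \<bar>Y \<omega>\<bar>)" using int_Y by simp
    have "norm (Z \<omega>) \<le> norm (1 + \<bar>Y \<omega>\<bar>)" for \<omega>
      using Y_le_Z[of \<omega>] Z_le[of \<omega>] by simp
    then show "AE \<omega> in \<Omega>. norm (Z \<omega>) \<le> norm (1 + \<bar>Y \<omega>\<bar>)" by simp
  qed auto
  have "gamma_fn M a th P v = 1 - (\<Sum>i=1..M. f i (v i))"
    using v unfolding gamma by (auto simp: dom_D_def)
  also have "\<dots> \<le> 1 - (\<Sum>i=1..M. \<integral>\<omega>. h i (A i \<omega>) \<partial>\<Omega>)"
    using h_le by (intro diff_left_mono sum_mono) auto
  also have "\<dots> = integral\<^sup>L \<Omega> Y"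
  proof -
    have "integrable \<Omega> (\<lambda>\<omega>. \<Sum>i=1..M. h i (A i \<omega>))"
      using int_h by (intro Bochner_Integration.integrable_sum)
    moreover have "(\<integral>\<omega>. (\<Sum>i=1..M. h i (A i \<omega>)) \<partial>\<Omega>) = (\<Sum>i=1..M. \<integral>\<omega>. h i (A i \<omega>) \<partial>\<Omega>)"
      using int_h by (intro Bochner_Integration.integral_sum)
    ultimately show ?thesis
      unfolding Y_def by (subst Bochner_Integration.integral_diff) (simp_all add: prob_space)
  qed
  also have "\<dots> \<le> integral\<^sup>L \<Omega> Z"
    using Y_le_Z by (intro integral_mono int_Y int_Z)
  also have "\<dots> = (\<integral>\<omega>. indicator {\<omega>. v 1 \<ge> V 1 \<omega>} \<omega> * gamma_fn M a th P (shift_min M v (\<lambda>i. V i \<omega>)) \<partial>\<Omega>)"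
    by (intro Bochner_Integration.integral_cong)
      (auto simp: gamma Z_def A_def w_def[symmetric] indicator_def)
  finally show ?thesis .
qed

theorem theorem6:
  fixes \<Omega> :: "'a measure" and M :: nat and V :: "nat \<Rightarrow> 'a \<Rightarrow> real"
    and a :: real and \<zeta> :: "nat \<Rightarrow> real" and K :: "nat \<Rightarrow> nat \<Rightarrow> real"
  assumes "prob_space \<Omega>" and "M \<ge> 1"
    and "\<And>i. i \<in> {1..M} \<Longrightarrow> V i \<in> borel_measurable \<Omega>"
    and "\<And>i. i \<in> {1..M} \<Longrightarrow> measure \<Omega> {\<omega>\<in>space \<Omega>. V i \<omega> > 0} > 0"
    and "\<And>i. i \<in> {1..M} \<Longrightarrow> ext_mean \<Omega> (V i) < 0"
    and "\<And>i. i \<in> {1..M} \<Longrightarrow> \<exists>r>0. exp_moment \<Omega> (V i) r < \<infinity>"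
    and "\<zeta> 1 = theta \<Omega> V 1"
    and "\<And>i. i \<in> {2..M} \<Longrightarrow>
          (if theta \<Omega> V (i - 1) = theta \<Omega> V i \<or> d_cnt \<Omega> V (i - 1) (theta \<Omega> V (i - 1)) = 0
           then \<zeta> i = theta \<Omega> V i
           else \<zeta> i \<in> {theta \<Omega> V i <..< theta \<Omega> V (i - 1)})"
    and "\<And>v i j. v \<in> dom_D M a \<Longrightarrow> i \<in> {1..M} \<Longrightarrow>
          j \<in> {1..max (d_cnt \<Omega> V (i - 1) (theta \<Omega> V (i - 1))) (d_cnt \<Omega> V i (theta \<Omega> V i))} \<Longrightarrow>
          odd j \<Longrightarrow> measure \<Omega> {\<omega>\<in>space \<Omega>. V i \<omega> > v i} > 0 \<Longrightarrow>
          cond_excess_moment \<Omega> (V i) (\<zeta> i) (v i) j \<le> ennreal (K i j)"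
  shows "\<exists>P :: nat \<Rightarrow> mvpoly.
          (\<forall>i\<in>{1..M}. mv_vars (P i) \<subseteq> {1..i} \<and> mv_has_degree (P i) (d_cnt \<Omega> V i (theta \<Omega> V i))) \<and>
          (\<forall>i\<in>{1..M}. \<forall>v\<in>dom_D M a. 0 \<le> mv_eval (P i) v) \<and>
          (\<forall>v\<in>{v. gamma_fn M a (theta \<Omega> V) P v > 0}.
             (\<integral>\<omega>. indicator {\<omega>. v 1 \<ge> V 1 \<omega>} \<omega> *
                 gamma_fn M a (theta \<Omega> V) P (shift_min M v (\<lambda>i. V i \<omega>)) \<partial>\<Omega>)
             \<ge> gamma_fn M a (theta \<Omega> V) P v)"
proof -
  interpret tandem \<Omega> M V
    using assms(1,3-6) by (rule tandem.intro)
  define \<theta> where "\<theta> = theta \<Omega> V"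
  define n where "n i = d_cnt \<Omega> V i (\<theta> i)" for i
  define F where "F i p x = fst p * (x + a + snd p) ^ n i * exp (- \<theta> i * x)" for i and p :: "real \<times> real" and x
  have n1: "n (Suc 0) = 0" by (simp add: n_def d_cnt_def)
  \<comment> \<open>The pairs \<open>p\<close> and \<open>q\<close> hold the factor and the shift of consecutive coordinates. The requirement
    that the factor is at least one is needed for \<open>f 1 \<ge> 1\<close> on the negative numbers.\<close>
  have step_ex: "\<exists>q. (1 \<le> fst q \<and> 1 \<le> snd q) \<and> (1 \<le> i \<and> Suc i \<le> M \<longrightarrow> (\<forall>x\<ge>- a.
      (\<integral>\<^sup>+\<omega>. ennreal (if - a \<le> x - V (Suc i) \<omega>
          then F (Suc i) q (x - V (Suc i) \<omega>) + F i p (x - V (Suc i) \<omega>) else 1) \<partial>\<Omega>)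
        \<le> ennreal (F (Suc i) q x)))"
    if p: "1 \<le> fst p \<and> 1 \<le> snd p" for p i
  proof (cases "1 \<le> i \<and> Suc i \<le> M")
    case False
    then show ?thesis by (auto intro!: exI[of _ "(1, 1)"])
  next
    case True
    then have i: "i \<in> {1..M}" and Si: "Suc i \<in> {1..M}" and Si2: "Suc i \<in> {2..M}" by auto
    \<comment> \<open>The count at the new exponent: it agrees with \<open>n i\<close> if the exponent stays the same.\<close>
    define e where "e = d_cnt \<Omega> V i (\<theta> (Suc i))"
    have t: "0 < \<theta> (Suc i)" "exp_moment \<Omega> (V (Suc i)) (\<theta> (Suc i)) \<le> 1"
      using theta_pos[OF Si] exp_moment_theta_le_1[OF Si, of "Suc i"] by (auto simp: \<theta>_def)
    have n: "n (Suc i) = e + (if exp_moment \<Omega> (V (Suc i)) (\<theta> (Suc i)) = 1 then 1 else 0)"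
      using True by (simp add: n_def e_def d_cnt_def I_ind_def)
    have "\<theta> (Suc i) < \<theta> i \<or> \<theta> (Suc i) = \<theta> i \<and> n i = e"
      using theta_Suc_le[OF i Si] by (auto simp: \<theta>_def n_def e_def)
    from poly_exp_dominated[OF _ _ this, of "snd p" "fst p" a]
    obtain A where A: "0 \<le> A"
      "\<And>x. - a \<le> x \<Longrightarrow> F i p x \<le> A * (x + a + 1) ^ e * exp (- \<theta> (Suc i) * x)"
      using p unfolding F_def by auto
    have crit: "integrable \<Omega> (\<lambda>\<omega>. exp (\<theta> (Suc i) * V (Suc i) \<omega>) * V (Suc i) \<omega>)"
      if "exp_moment \<Omega> (V (Suc i)) (\<theta> (Suc i)) = 1"
    proof (rule integrable_exp_mult_of_cond_excess[OF prob meas[OF Si] t])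
      show "\<theta> (Suc i) \<le> \<zeta> (Suc i)"
        using assms(8)[OF Si2] by (auto simp: \<theta>_def split: if_splits)
      have "1 \<le> n (Suc i)" using that n by simp
      then show "cond_excess_moment \<Omega> (V (Suc i)) (\<zeta> (Suc i)) (- a) 1 \<le> ennreal (K (Suc i) 1)"
        if "0 < measure \<Omega> {\<omega> \<in> space \<Omega>. - a < V (Suc i) \<omega>}"
        using assms(9)[of "\<lambda>_. - a" "Suc i" 1] Si that
        by (auto simp: dom_D_def n_def \<theta>_def)
    qed
    from one_step_drift[OF prob meas[OF Si] pos[OF Si] t crit n A]
    obtain c s where "1 \<le> c" "1 \<le> s" "\<forall>x\<ge>- a.
      (\<integral>\<^sup>+\<omega>. ennreal (if - a \<le> x - V (Suc i) \<omega>
          then F (Suc i) (c, s) (x - V (Suc i) \<omega>) + F i p (x - V (Suc i) \<omega>) else 1) \<partial>\<Omega>)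
        \<le> ennreal (F (Suc i) (c, s) x)"
      unfolding F_def fst_conv snd_conv by blast
    then show ?thesis by (intro exI[of _ "(c, s)"]) auto
  qed
  have "\<exists>p. \<forall>i. (1 \<le> fst (p i) \<and> 1 \<le> snd (p i)) \<and> (1 \<le> i \<and> Suc i \<le> M \<longrightarrow> (\<forall>x\<ge>- a.
      (\<integral>\<^sup>+\<omega>. ennreal (if - a \<le> x - V (Suc i) \<omega>
          then F (Suc i) (p (Suc i)) (x - V (Suc i) \<omega>) + F i (p i) (x - V (Suc i) \<omega>) else 1) \<partial>\<Omega>)
        \<le> ennreal (F (Suc i) (p (Suc i)) x)))"
    by (rule dependent_nat_choice[where P = "\<lambda>i p. 1 \<le> fst p \<and> 1 \<le> snd p"])
      (use step_ex in \<open>auto intro: exI[of _ "(1, 1)"]\<close>)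
  then obtain p where p: "\<And>i. 1 \<le> fst (p i)" "\<And>i. 1 \<le> snd (p i)"
    and p_step: "\<And>i x. 1 \<le> i \<Longrightarrow> Suc i \<le> M \<Longrightarrow> - a \<le> x \<Longrightarrow>
      (\<integral>\<^sup>+\<omega>. ennreal (if - a \<le> x - V (Suc i) \<omega>
          then F (Suc i) (p (Suc i)) (x - V (Suc i) \<omega>) + F i (p i) (x - V (Suc i) \<omega>) else 1) \<partial>\<Omega>)
        \<le> ennreal (F (Suc i) (p (Suc i)) x)"
    by blast
  define f where "f i = F i (p i)" for i
  define P where "P i = uni_mvpoly i (Polynomial.smult (fst (p i)) ([:a + snd (p i), 1:] ^ n i))" for i
  have P_eval: "mv_eval (P i) w = fst (p i) * (w i + a + snd (p i)) ^ n i" for i w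
    by (simp add: P_def mv_eval_uni_mvpoly add_ac)
  have P_deg: "mv_has_degree (P i) (n i)" for i
  proof -
    have "degree (Polynomial.smult (fst (p i)) ([:a + snd (p i), 1:] ^ n i)) = n i"
      using p(1)[of i] by (simp add: degree_linear_power)
    moreover have "Polynomial.smult (fst (p i)) ([:a + snd (p i), 1:] ^ n i) \<noteq> 0"
      using p(1)[of i] by simp
    ultimately show ?thesis
      unfolding P_def using mv_has_degree_uni_mvpoly by metis
  qed
  have f1: "f 1 x = fst (p 1) * exp (- \<theta> 1 * x)" for x
    by (simp add: f_def F_def n1)
  have one: "1 \<in> {1..M}" using assms(2) by auto
  have P_nonneg: "0 \<le> mv_eval (P i) w" if "i \<in> {1..M}" "w \<in> dom_D M a" for i w
  proof (cases "i = 1")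
    case True
    then show ?thesis using p(1)[of 1] by (simp add: P_eval n1)
  next
    case False
    then have "- a \<le> w i" using that by (auto simp: dom_D_def)
    then show ?thesis using p(1,2)[of i] unfolding P_eval by (intro mult_nonneg_nonneg) auto
  qed
  have drift: "gamma_fn M a \<theta> P v \<le>
    (\<integral>\<omega>. indicator {\<omega>. v 1 \<ge> V 1 \<omega>} \<omega> * gamma_fn M a \<theta> P (shift_min M v (\<lambda>i. V i \<omega>)) \<partial>\<Omega>)"
    if v: "v \<in> dom_D M a" for v
  proof (rule drift_inequality[where f = f, OF prob assms(2) meas _ _ _ _ _ _ _ v])
    show "f i \<in> borel_measurable borel" for i
      unfolding f_def F_def by measurable
    show "mv_eval (P i) w * exp (- \<theta> i * w i) = f i (w i)" for i w
      by (simp add: P_eval f_def F_def)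
    show "0 \<le> f 1 x" for x unfolding f1 using p(1)[of 1] by simp
    show "1 \<le> f 1 x" if "x < 0" for x
    proof -
      have "1 \<le> exp (- \<theta> 1 * x)" using that theta_pos[OF one] by (simp add: \<theta>_def mult_le_0_iff)
      then have "1 * 1 \<le> fst (p 1) * exp (- \<theta> 1 * x)" using p(1)[of 1] by (intro mult_mono) auto
      then show ?thesis unfolding f1 by simp
    qed
    show "0 \<le> f i x" if "- a \<le> x" for i x
      unfolding f_def F_def using p(1,2)[of i] that by (intro mult_nonneg_nonneg) auto
    show "(\<integral>\<^sup>+\<omega>. ennreal (f 1 (x - V 1 \<omega>)) \<partial>\<Omega>) \<le> ennreal (f 1 x)" for x
    proof -
      have "(\<integral>\<^sup>+\<omega>. ennreal (f 1 (x - V 1 \<omega>)) \<partial>\<Omega>)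
          = (\<integral>\<^sup>+\<omega>. ennreal (f 1 x) * ennreal (exp (\<theta> 1 * V 1 \<omega>)) \<partial>\<Omega>)"
        using p(1)[of 1]
        by (intro nn_integral_cong, unfold f1)
          (simp add: ennreal_mult'[symmetric] algebra_simps flip: exp_add)
      also have "\<dots> = ennreal (f 1 x) * exp_moment \<Omega> (V 1) (\<theta> 1)"
        unfolding exp_moment_def using meas[OF one] by (intro nn_integral_cmult) auto
      also have "\<dots> \<le> ennreal (f 1 x) * 1"
        using exp_moment_theta_le_1[OF one, of 1] by (intro mult_left_mono) (auto simp: \<theta>_def)
      finally show ?thesis by simp
    qed
    show "(\<integral>\<^sup>+\<omega>. ennreal (if - a \<le> x - V i \<omega> then f i (x - V i \<omega>) + f (i - 1) (x - V i \<omega>) else 1) \<partial>\<Omega>)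
        \<le> ennreal (f i x)" if "i \<in> {2..M}" "- a \<le> x" for i x
    proof -
      obtain k where k: "i = Suc k" "1 \<le> k" using \<open>i \<in> {2..M}\<close> by (cases i) auto
      then show ?thesis
        using p_step[of k x] that unfolding f_def k(1) diff_Suc_1 by simp
    qed
  qed
  have "v \<in> dom_D M a" if "gamma_fn M a \<theta> P v > 0" for v
    using that by (cases "v \<in> dom_D M a") (simp_all add: gamma_fn_def)
  then show ?thesis
    using P_deg P_nonneg drift mv_vars_uni_mvpoly
    unfolding \<theta>_def[symmetric]
    by (intro exI[of _ P]) (force simp: P_def n_def)
qed

end
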